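(* For any positive integers $m\ge n$, a representation $V$ of $\mathcal{T}_{n,m}$ is irreducible if and only if $V$ is one-dimensional. Moreover, up to isomorphism, these are classified by a choice of scalars $\{\lambda_T\in\mathbb{K}\mid T\in G_{n,m}\}$ satisfying the relations given by $\mathcal{P}_{n,m}$. These scalars uniquely determine the linear maps $\rho:\mathcal{T}_{n,m}\to\mathrm{End}(V)$ which induce the structure maps $\rho(T):V\to V$ given by linearly extending $\rho(T)(v)=\lambda_Tv$ for each $T\in G_{n,m}$.
   Context: Let $\mathbb{K}$ be an algebraically closed field of characteristic zero. A semistandard Young tableau of partition shape $\lambda$ is a filling of the Ferrers diagram of $\lambda$ (English notation) with positive integers, strictly increasing down columns and weakly increasing from left to right along rows. For positive integers $m\ge n$, $\mathrm{SSYT}_m^n$ denotes the set of all semistandard Young tableaux of all partition shapes with at most $n$ rows and with entries in $\{1,\dots,m\}$ (including the empty tableau $\emptyset$). For $T$ of shape $\lambda$ and $T'$ of shape $\mu$, $T\star T'$ is the semistandard Young tableau of shape $\lambda+\mu$ obtained by horizontally concatenating the rows of $T$ and $T'$ and sorting the entries in each row in weakly increasing order. $(\mathrm{SSYT}_m^n,\star,\emptyset)$ is a commutative monoid, and the tableaux algebra $\mathcal{T}_{n,m}$ is its (unital) monoid algebra over $\mathbb{K}$. $G_{n,m}$ is the set of tableaux in $\mathrm{SSYT}_m^n$ with exactly one column, i.e. of shape $(1^k)$ with $1\le k\le n$; it generates $\mathcal{T}_{n,m}$. $\mathcal{P}_{n,m}$ is the ideal of the polynomial ring $\mathbb{K}[G_{n,m}]$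 generated by all $T_1T_2-T_3T_4$ with $T_1,T_2,T_3,T_4\in G_{n,m}$ distinct and $T_1\star T_2=T_3\star T_4$; the scalars $(\lambda_T)$ satisfy the relations given by $\mathcal{P}_{n,m}$ if $\lambda_{T_1}\lambda_{T_2}=\lambda_{T_3}\lambda_{T_4}$ for all such quadruples. *)

theory Defs
  imports Complex_Main "HOL-Library.FuncSet" "HOL-Library.Multiset" "HOL-Library.Poly_Mapping"
    "HOL-Computational_Algebra.Polynomial"
begin

section \<open>Semistandard Young tableaux\<close>

text \<open>A tableau is the list of its rows, top to bottom. Rows are nonempty, so that the list
  determines and is determined by the filled Ferrers diagram.\<close>

definition above :: "nat list \<Rightarrow> nat list \<Rightarrow> bool" where
  "above r s \<longleftrightarrow> length s \<le> length r \<and> (\<forall>j<length s. r ! j < s ! j)"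

definition ssyt :: "nat list list \<Rightarrow> bool" where
  "ssyt T \<longleftrightarrow> (\<forall>r\<in>set T. r \<noteq> [] \<and> sorted r \<and> 0 \<notin> set r) \<and> sorted_wrt above T"

fun star_rows :: "nat list list \<Rightarrow> nat list list \<Rightarrow> nat list list" where
  "star_rows [] T = T"
| "star_rows S [] = S"
| "star_rows (r # S) (s # T) = sort (r @ s) # star_rows S T"

lemma above_iff_count:
  assumes "sorted r" "sorted s"
  shows "above r s \<longleftrightarrow> length s \<le> length r \<and>
    (\<forall>x. length (filter (\<lambda>y. y \<le> x) s) \<le> length (filter (\<lambda>y. y < x) r))"
proof (intro iffI conjI allI)
  assume A: "above r s"
  then show "length s \<le> length r" by (simp add: above_def)
  fix x
  have "{i. i < length s \<and> s ! i \<le> x} \<subseteq> {i. i < length r \<and> r ! i < x}"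
    using A by (auto simp: above_def dest: less_le_trans)
  then show "length (filter (\<lambda>y. y \<le> x) s) \<le> length (filter (\<lambda>y. y < x) r)"
    unfolding length_filter_conv_card by (intro card_mono) auto
next
  assume B: "length s \<le> length r \<and>
    (\<forall>x. length (filter (\<lambda>y. y \<le> x) s) \<le> length (filter (\<lambda>y. y < x) r))"
  have "r ! j < s ! j" if j: "j < length s" for j
  proof (rule ccontr)
    assume C: "\<not> r ! j < s ! j"
    have "{i. i < length r \<and> r ! i < s ! j} \<subseteq> {..<j}"
    proof safe
      fix i assume i: "i < length r" "r ! i < s ! j"
      show "i < j"
      proof (rule ccontr)
        assume "\<not> i < j"
        then have "r ! j \<le> r ! i"
          using assms(1) i by (simp add: sorted_iff_nth_mono)
        then show False using C i by simp
      qed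
    qed
    then have "card {i. i < length r \<and> r ! i < s ! j} \<le> card {..<j}"
      by (intro card_mono) auto
    then have 1: "length (filter (\<lambda>y. y < s ! j) r) \<le> j"
      by (simp add: length_filter_conv_card)
    have "{..j} \<subseteq> {i. i < length s \<and> s ! i \<le> s ! j}"
      using j assms(2) by (auto simp: sorted_iff_nth_mono)
    then have "card {..j} \<le> card {i. i < length s \<and> s ! i \<le> s ! j}"
      by (intro card_mono) auto
    then have 2: "Suc j \<le> length (filter (\<lambda>y. y \<le> s ! j) s)"
      by (simp add: length_filter_conv_card)
    from 1 2 B show False by (meson le_trans not_less_eq_eq)
  qed
  with B show "above r s" by (simp add: above_def)
qed

lemma above_sort_append:
  assumes "above r s" "above r' s'" "sorted r" "sorted s" "sorted r'" "sorted s'"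
  shows "above (sort (r @ r')) (sort (s @ s'))"
  using assms(1,2)
  by (auto simp: above_iff_count assms(3-) filter_sort add_mono)

lemma above_Nil [simp]: "above r []"
  by (simp add: above_def)

lemma mem_star_rows:
  assumes "x \<in> set (star_rows S T)" "\<forall>r\<in>set S. sorted r" "\<forall>r\<in>set T. sorted r"
  shows "\<exists>a\<in>insert [] (set S). \<exists>b\<in>insert [] (set T). x = sort (a @ b)"
  using assms
proof (induction S T rule: star_rows.induct)
  case (1 T)
  then show ?case by (auto simp: sorted_sort_id intro!: bexI[of _ x])
next
  case (2 v va)
  then show ?case by (intro bexI[of _ x] bexI[of _ "[]"]) (auto simp: sorted_sort_id)
next
  case (3 r S s T)
  then show ?case by auto
qed

lemma ssyt_Nil: "ssyt []"
  by (simp add: ssyt_def)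

lemma ssyt_star_rows:
  assumes "ssyt S" "ssyt T"
  shows "ssyt (star_rows S T)"
  using assms
proof (induction S T rule: star_rows.induct)
  case (3 r S s T)
  have "ssyt S" "ssyt T"
    using 3(2,3) by (simp_all add: ssyt_def)
  then have IH: "ssyt (star_rows S T)"
    by (rule 3(1))
  have sr: "sorted r" "sorted s" "\<forall>r\<in>set S. sorted r" "\<forall>r\<in>set T. sorted r"
    and ab: "\<forall>x\<in>insert [] (set S). above r x" "\<forall>x\<in>insert [] (set T). above s x"
    using 3(2,3) by (simp_all add: ssyt_def)
  have "above (sort (r @ s)) x" if x_in: "x \<in> set (star_rows S T)" for x
  proof -
    obtain a b where a: "a \<in> insert [] (set S)" and b: "b \<in> insert [] (set T)"
      and x: "x = sort (a @ b)"
      using mem_star_rows[OF x_in sr(3,4)] by blast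
    have "sorted a" "sorted b" using a b sr by auto
    then show ?thesis unfolding x using a b sr(1,2) ab by (intro above_sort_append) blast+
  qed
  moreover have "sort (r @ s) \<noteq> []" "0 \<notin> set (sort (r @ s))"
    using 3(2,3) by (auto simp: ssyt_def simp flip: length_greater_0_conv)
  ultimately show ?case using IH by (auto simp: ssyt_def)
qed auto

lemma sort_append_commute: "sort (a @ b) = sort (b @ a :: nat list)"
  by (rule properties_for_sort) auto

lemma sort_append_assoc:
  "sort (sort (a @ b) @ c) = sort (a @ sort (b @ c) :: nat list)"
  by (rule properties_for_sort) auto

lemma star_rows_Nil2 [simp]: "star_rows S [] = S"
  by (cases S) auto

lemma star_rows_commute: "star_rows S T = star_rows T S"
  by (induction S T rule: star_rows.induct) (auto simp: sort_append_commute)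

lemma star_rows_assoc: "star_rows (star_rows S T) U = star_rows S (star_rows T U)"
proof (induction S T arbitrary: U rule: star_rows.induct)
  case (3 r S s T)
  then show ?case by (cases U) (auto simp: sort_append_assoc)
qed auto

typedef tableau = "{T. ssyt T}"
  morphisms rows Tableau
  using ssyt_Nil by blast

setup_lifting type_definition_tableau

text \<open>The monoid operation \<open>\<star>\<close> is written additively, because \<^typ>\<open>'a \<Rightarrow>\<^sub>0 'k\<close> with its
  convolution product is the monoid algebra of an additively written monoid \<^typ>\<open>'a\<close>.\<close>

instantiation tableau :: comm_monoid_add
begin

lift_definition zero_tableau :: tableau is "[]"
  by (rule ssyt_Nil)

lift_definition plus_tableau :: "tableau \<Rightarrow> tableau \<Rightarrow> tableau" is star_rows
  by (rule ssyt_star_rows)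

instance
proof
  fix S T U :: tableau
  show "S + T + U = S + (T + U)"
    by transfer (rule star_rows_assoc)
  show "S + T = T + S"
    by transfer (rule star_rows_commute)
  show "0 + S = S"
    by transfer simp
qed

end

definition SSYT :: "nat \<Rightarrow> nat \<Rightarrow> tableau set" where
  "SSYT n m = {T. length (rows T) \<le> n \<and> (\<forall>r\<in>set (rows T). set r \<subseteq> {1..m})}"

definition one_column :: "nat \<Rightarrow> nat \<Rightarrow> tableau set" where
  "one_column n m = {T \<in> SSYT n m. rows T \<noteq> [] \<and> (\<forall>r\<in>set (rows T). length r = 1)}"


section \<open>The tableaux algebra\<close>

text \<open>The monoid algebra of \<^term>\<open>SSYT n m\<close>, as a unital subalgebra of the monoid algebra of
  all tableaux. The basis element of a tableau \<open>T\<close> is \<^term>\<open>Poly_Mapping.single T 1\<close>.\<close>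

definition tableaux_algebra :: "nat \<Rightarrow> nat \<Rightarrow> (tableau \<Rightarrow>\<^sub>0 'k::field) set" where
  "tableaux_algebra n m = {a. Poly_Mapping.keys a \<subseteq> SSYT n m}"

lemma SSYT_zero: "0 \<in> SSYT n m"
  by (simp add: SSYT_def zero_tableau.rep_eq)

lemma SSYT_plus:
  assumes "S \<in> SSYT n m" "T \<in> SSYT n m"
  shows "S + T \<in> SSYT n m"
proof -
  have "length (star_rows S T) = max (length S) (length T)" for S T
    by (induction S T rule: star_rows.induct) auto
  then have len: "length (rows (S + T)) = max (length (rows S)) (length (rows T))"
    unfolding plus_tableau.rep_eq .
  have "\<forall>r\<in>set (star_rows S T). set r \<subseteq> A"
    if "\<forall>r\<in>set S. set r \<subseteq> A" "\<forall>r\<in>set T. set r \<subseteq> A" for S T A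
    using that by (induction S T rule: star_rows.induct) auto
  from this[of "rows S" "{1..m}" "rows T"]
  have "\<forall>r\<in>set (rows (S + T)). set r \<subseteq> {1..m}"
    using assms unfolding SSYT_def plus_tableau.rep_eq by blast
  with len assms show ?thesis
    by (simp add: SSYT_def)
qed

lemma tableaux_algebra_closed:
  shows "1 \<in> tableaux_algebra n m"
    and "a \<in> tableaux_algebra n m \<Longrightarrow> b \<in> tableaux_algebra n m \<Longrightarrow> a + b \<in> tableaux_algebra n m"
    and "a \<in> tableaux_algebra n m \<Longrightarrow> b \<in> tableaux_algebra n m \<Longrightarrow> a * b \<in> tableaux_algebra n m"
    and "a \<in> tableaux_algebra n m \<Longrightarrow> Poly_Mapping.map (times c) a \<in> tableaux_algebra n m"
    and "T \<in> SSYT n m \<Longrightarrow> Poly_Mapping.single T 1 \<in> tableaux_algebra n m"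
proof -
  show "1 \<in> tableaux_algebra n m"
    by (simp add: tableaux_algebra_def SSYT_zero)
  show "a + b \<in> tableaux_algebra n m"
    if "a \<in> tableaux_algebra n m" "b \<in> tableaux_algebra n m"
    using that Poly_Mapping.keys_add[of a b] by (auto simp: tableaux_algebra_def)
  show "a * b \<in> tableaux_algebra n m"
    if "a \<in> tableaux_algebra n m" "b \<in> tableaux_algebra n m"
    using that keys_mult[of a b] SSYT_plus by (fastforce simp: tableaux_algebra_def)
  show "Poly_Mapping.map (times c) a \<in> tableaux_algebra n m" if "a \<in> tableaux_algebra n m"
    using that by (auto simp: tableaux_algebra_def in_keys_iff map.rep_eq when_def split: if_splits)
  show "Poly_Mapping.single T 1 \<in> tableaux_algebra n m" if "T \<in> SSYT n m"
    using that by (simp add: tableaux_algebra_def)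
qed


section \<open>Representations\<close>

text \<open>A representation is a unital algebra homomorphism from the tableaux algebra to the
  endomorphisms of a vector space, with no bound on the dimension of that space. It is
  extensional, i.e. has the fixed value \<^term>\<open>undefined\<close> outside the tableaux algebra, so that
  equality of representations is equality of maps on the tableaux algebra.\<close>

definition representation ::
  "nat \<Rightarrow> nat \<Rightarrow> ('k::field \<Rightarrow> 'v::ab_group_add \<Rightarrow> 'v) \<Rightarrow> ((tableau \<Rightarrow>\<^sub>0 'k) \<Rightarrow> 'v \<Rightarrow> 'v) \<Rightarrow> bool"
  where
  "representation n m scale \<rho> \<longleftrightarrow>
     vector_space scale \<and>
     \<rho> \<in> tableaux_algebra n m \<rightarrow>\<^sub>E {f. Vector_Spaces.linear scale scale f} \<and>
     \<rho> 1 = id \<and>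
     (\<forall>a\<in>tableaux_algebra n m. \<forall>b\<in>tableaux_algebra n m.
        \<rho> (a + b) = (\<lambda>v. \<rho> a v + \<rho> b v) \<and> \<rho> (a * b) = \<rho> a \<circ> \<rho> b) \<and>
     (\<forall>c. \<forall>a\<in>tableaux_algebra n m.
        \<rho> (Poly_Mapping.map (times c) a) = (\<lambda>v. scale c (\<rho> a v)))"

definition irreducible_representation ::
  "nat \<Rightarrow> nat \<Rightarrow> ('k::field \<Rightarrow> 'v::ab_group_add \<Rightarrow> 'v) \<Rightarrow> ((tableau \<Rightarrow>\<^sub>0 'k) \<Rightarrow> 'v \<Rightarrow> 'v) \<Rightarrow> bool"
  where
  "irreducible_representation n m scale \<rho> \<longleftrightarrow>
     representation n m scale \<rho> \<and> (UNIV :: 'v set) \<noteq> {0} \<and>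
     (\<forall>W. module.subspace scale W \<and> (\<forall>a\<in>tableaux_algebra n m. \<rho> a ` W \<subseteq> W)
        \<longrightarrow> W = {0} \<or> W = UNIV)"

definition isomorphic_representations ::
  "nat \<Rightarrow> nat \<Rightarrow> ('k::field \<Rightarrow> 'v::ab_group_add \<Rightarrow> 'v) \<Rightarrow> ((tableau \<Rightarrow>\<^sub>0 'k) \<Rightarrow> 'v \<Rightarrow> 'v) \<Rightarrow>
   ('k \<Rightarrow> 'w::ab_group_add \<Rightarrow> 'w) \<Rightarrow> ((tableau \<Rightarrow>\<^sub>0 'k) \<Rightarrow> 'w \<Rightarrow> 'w) \<Rightarrow> bool"
  where
  "isomorphic_representations n m scale \<rho> scale' \<rho>' \<longleftrightarrow>
     (\<exists>f. Vector_Spaces.linear scale scale' f \<and> bij f \<and>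
        (\<forall>a\<in>tableaux_algebra n m. f \<circ> \<rho> a = \<rho>' a \<circ> f))"

text \<open>Families of scalars indexed by the one-column tableaux (again as extensional functions)
  that satisfy the relations given by \<open>\<P>\<^sub>n\<^sub>,\<^sub>m\<close>.\<close>

definition scalar_families :: "nat \<Rightarrow> nat \<Rightarrow> (tableau \<Rightarrow> 'k::field) set" where
  "scalar_families n m = {\<mu> \<in> one_column n m \<rightarrow>\<^sub>E UNIV.
     \<forall>T1\<in>one_column n m. \<forall>T2\<in>one_column n m. \<forall>T3\<in>one_column n m. \<forall>T4\<in>one_column n m.
       distinct [T1, T2, T3, T4] \<and> T1 + T2 = T3 + T4 \<longrightarrow> \<mu> T1 * \<mu> T2 = \<mu> T3 * \<mu> T4}"

definition acts_by_scalars ::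
  "nat \<Rightarrow> nat \<Rightarrow> ('k::field \<Rightarrow> 'v::ab_group_add \<Rightarrow> 'v) \<Rightarrow> ((tableau \<Rightarrow>\<^sub>0 'k) \<Rightarrow> 'v \<Rightarrow> 'v) \<Rightarrow>
   (tableau \<Rightarrow> 'k) \<Rightarrow> bool"
  where
  "acts_by_scalars n m scale \<rho> \<mu> \<longleftrightarrow>
     (\<forall>T\<in>one_column n m. \<forall>v. \<rho> (Poly_Mapping.single T 1) v = scale (\<mu> T) v)"

end

theory Submission
  imports Defs
begin

text \<open>
  Two facts carry the theorem: a form of Hilbert's Nullstellensatz, and the fact that quadratic
  relations present the monoid of tableaux.

  \<^emph>\<open>Irreducible means one-dimensional.\<close> Let \<open>V\<close> be an irreducible representation of the commutative
  algebra \<open>A\<close> of tableaux and let \<open>I\<close> be its annihilator. The kernel and the image of each \<open>\<rho> a\<close> are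
  subrepresentations, so \<open>\<rho> a\<close> is zero or bijective, and \<open>A / I\<close> is a field. It is finitely
  generated over \<open>\<K>\<close>, because \<open>A\<close> is generated by the finitely many one-column tableaux. Since
  \<open>V\<close> may have infinite dimension and \<open>\<K>\<close> may be countable, neither an eigenvector of a matrix nor
  a dimension count is available to produce an eigenvalue; instead one constructs a homomorphism
  \<open>\<psi> : A / I \<rightarrow> \<K>\<close> that fixes \<open>\<K>\<close>. This is \<open>extend_hom\<close>: if the domain \<open>S\<close> arises from a subring \<open>R\<close> by
  adjoining finitely many elements, then every homomorphism from \<open>R\<close> to \<open>\<K>\<close> that does not vanish at a
  suitable nonzero element of \<open>R\<close> extends to \<open>S\<close>. A homomorphism out of a field is injective, so
  \<open>a - \<psi> a\<close>, which \<open>\<psi>\<close> sends to zero, lies in \<open>I\<close>. Hence \<open>a\<close> acts by the scalar \<open>\<psi> a\<close>, every subspace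
  of \<open>V\<close> is invariant, and \<open>V\<close> is a line.

  \<^emph>\<open>Every family of scalars occurs.\<close> The one-column tableaux form a distributive lattice: order
  columns entrywise, with a missing entry larger than every number. Meet and join are the
  entrywise minimum and maximum, and \<open>c + d = meet c d + join c d\<close> because sorting a row of length
  two amounts to taking its minimum and its maximum. These quadratic relations turn any list of
  columns into a chain with the same sum (\<open>chain_normal_form\<close>). The columns of a chain can be read
  off from the sum (\<open>chain_unique\<close>), since its rows list the entries of the chain in order. So a
  family that respects the quadratic relations gives a product over columns that depends only on
  the sum of the columns, that is, a multiplicative function on tableaux (\<open>character\<close>). Its linear
  extension is an algebra homomorphism, and with it the algebra acts by scalars on any vector space.

  The remaining claims follow because a representation in which the generators act by the scalars
  \<open>\<mu>\<close> is determined on the algebra that they generate.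
\<close>

section \<open>Extending homomorphisms into an algebraically closed field\<close>
text \<open>The subrings in question are subsets of one fixed ring type, so that a chain of ring extensions of
arbitrary length, such as \<open>adjoin_list\<close> below, stays inside one type.\<close>

definition subring :: "'a::comm_ring_1 set \<Rightarrow> bool" where
  "subring R \<longleftrightarrow> 1 \<in> R \<and> (\<forall>a\<in>R. \<forall>b\<in>R. a - b \<in> R \<and> a * b \<in> R)"

lemma subringD:
  assumes "subring R"
  shows "1 \<in> R" "0 \<in> R"
    and "a \<in> R \<Longrightarrow> b \<in> R \<Longrightarrow> a - b \<in> R"
    and "a \<in> R \<Longrightarrow> b \<in> R \<Longrightarrow> a + b \<in> R"
    and "a \<in> R \<Longrightarrow> b \<in> R \<Longrightarrow> a * b \<in> R"
    and "a \<in> R \<Longrightarrow> - a \<in> R"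
    and "a \<in> R \<Longrightarrow> a ^ k \<in> R"
proof -
  note R = assms[unfolded subring_def]
  show "1 \<in> R" using R by blast
  show minus: "a - b \<in> R" if "a \<in> R" "b \<in> R" for a b using R that by blast
  from minus[of 1 1] R show zero: "0 \<in> R" by simp
  show uminus: "- a \<in> R" if "a \<in> R" for a using minus[OF zero that] by simp
  show "a + b \<in> R" if "a \<in> R" "b \<in> R" for a b
    using minus[OF that(1) uminus[OF that(2)]] by simp
  show mult: "a * b \<in> R" if "a \<in> R" "b \<in> R" for a b using R that by blast
  show "a ^ k \<in> R" if "a \<in> R" using that R by (induction k) auto
qed

lemma subring_sum:
  assumes "subring R" "\<And>i. i \<in> A \<Longrightarrow> f i \<in> R"
  shows "sum f A \<in> R"
  using assms(2) by (induction A rule: infinite_finite_induct) (auto intro: subringD[OF assms(1)])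

definition polys_over :: "'a::comm_ring_1 set \<Rightarrow> 'a poly set" where
  "polys_over R = {p. \<forall>i. coeff p i \<in> R}"

lemma subring_polys_over:
  assumes "subring R"
  shows "subring (polys_over R)"
  unfolding subring_def polys_over_def
  by (auto simp: coeff_mult subringD[OF assms] intro!: subring_sum[OF assms])

lemma monom_polys_over:
  assumes "subring R" "c \<in> R"
  shows "monom c i \<in> polys_over R"
  using assms by (auto simp: polys_over_def subringD)

lemma smult_polys_over:
  assumes "subring R" "c \<in> R" "p \<in> polys_over R"
  shows "smult c p \<in> polys_over R"
  using assms by (auto simp: polys_over_def subringD)

lemma const_polys_over:
  assumes "subring R" "c \<in> R"
  shows "[:c:] \<in> polys_over R"
  using monom_polys_over[OF assms, of 0] by (simp add: monom_0)

definition adjoin :: "'a::comm_ring_1 set \<Rightarrow> 'a \<Rightarrow> 'a set" where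
  "adjoin R x = {poly p x | p. p \<in> polys_over R}"

lemma subring_adjoin:
  assumes "subring R"
  shows "subring (adjoin R x)"
proof -
  note P = subringD[OF subring_polys_over[OF assms]]
  have "1 \<in> adjoin R x"
    unfolding adjoin_def using P(1) by (auto intro!: exI[of _ 1])
  moreover have "a - b \<in> adjoin R x \<and> a * b \<in> adjoin R x"
    if "a \<in> adjoin R x" "b \<in> adjoin R x" for a b
    using that unfolding adjoin_def by (auto intro: P simp flip: poly_diff poly_mult)
  ultimately show ?thesis unfolding subring_def by blast
qed

lemma adjoin_superset:
  assumes "subring R"
  shows "R \<subseteq> adjoin R x"
proof
  fix c assume "c \<in> R"
  then show "c \<in> adjoin R x"
    unfolding adjoin_def using const_polys_over[OF assms, of c] by (auto intro!: exI[of _ "[:c:]"])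
qed

lemma adjoin_generator:
  assumes "subring R"
  shows "x \<in> adjoin R x"
  unfolding adjoin_def
  using monom_polys_over[OF assms subringD(1)[OF assms], of 1]
  by (auto intro!: exI[of _ "monom 1 1"] simp: poly_monom)

lemma poly_in_adjoin: "p \<in> polys_over R \<Longrightarrow> poly p x \<in> adjoin R x"
  unfolding adjoin_def by blast

text \<open>The bound on the degree of the quotient is part of the statement because the ring may have zero
divisors: the degree of \<open>q\<close> cannot be recovered from that of \<open>q * f\<close>.\<close>

lemma pseudo_division_over_subring:
  fixes f g :: "'a::comm_ring_1 poly"
  assumes R: "subring R" and f: "f \<in> polys_over R" "degree f > 0" and g: "g \<in> polys_over R"
  shows "\<exists>k. \<exists>q\<in>polys_over R. \<exists>r\<in>polys_over R. smult (lead_coeff f ^ k) g = q * f + r \<and>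
    degree r < degree f \<and> degree q \<le> degree g - degree f"
  using g
proof (induction "degree g" arbitrary: g rule: less_induct)
  case less
  note P = subringD[OF subring_polys_over[OF R]]
  show ?case
  proof (cases "degree g < degree f")
    case True
    then show ?thesis using less P
      by (intro exI[of _ 0] bexI[of _ 0] bexI[of _ g]) auto
  next
    case False
    define c where "c = lead_coeff f"
    define d where "d = degree g - degree f"
    define t where "t = monom (lead_coeff g) d"
    define h where "h = smult c g - t * f"
    have c: "c \<in> R" and t: "t \<in> polys_over R"
      using f less(2) unfolding c_def t_def
      by (auto intro!: monom_polys_over[OF R]) (auto simp: polys_over_def)
    have h: "h \<in> polys_over R"
      unfolding h_def using c t f less(2) by (intro P smult_polys_over[OF R])
    have dt: "degree (t * f) \<le> degree g"
    proof -
      have "degree (t * f) \<le> degree t + degree f" by (rule degree_mult_le)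
      also have "\<dots> \<le> d + degree f" by (simp add: t_def degree_monom_le)
      also have "\<dots> = degree g" using False by (simp add: d_def)
      finally show ?thesis .
    qed
    have "coeff (t * f) (d + degree f) = lead_coeff g * c"
      by (simp add: t_def c_def coeff_monom_mult)
    then have "coeff h (degree g) = 0"
      using False by (simp add: h_def d_def mult.commute)
    moreover have "degree h \<le> degree g"
      unfolding h_def using dt by (intro degree_diff_le) (auto intro: order.trans[OF degree_smult_le])
    ultimately have hg: "degree h < degree g"
      using False f(2) by (metis eq_zero_or_degree_less degree_0 not_gr_zero not_less)
    from less(1)[OF hg h] obtain k q r where q: "q \<in> polys_over R" and r: "r \<in> polys_over R"
      and eq: "smult (c ^ k) h = q * f + r" "degree r < degree f" "degree q \<le> degree h - degree f"
      unfolding c_def by blast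
    have "smult (c ^ Suc k) g = smult (c ^ k) (h + t * f)"
      by (simp add: h_def mult.commute)
    also have "\<dots> = (q + smult (c ^ k) t) * f + r"
      by (simp add: smult_add_right eq algebra_simps)
    finally have 1: "smult (c ^ Suc k) g = (q + smult (c ^ k) t) * f + r" .
    have 2: "q + smult (c ^ k) t \<in> polys_over R"
      using q t c by (intro P smult_polys_over[OF R] subringD[OF R])
    have 3: "degree (q + smult (c ^ k) t) \<le> degree g - degree f"
    proof (intro degree_add_le)
      show "degree q \<le> degree g - degree f" using eq(3) hg by simp
      have "degree (smult (c ^ k) t) \<le> degree t" by (rule degree_smult_le)
      also have "\<dots> \<le> d" by (simp add: t_def degree_monom_le)
      finally show "degree (smult (c ^ k) t) \<le> degree g - degree f" by (simp add: d_def)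
    qed
    show ?thesis unfolding c_def[symmetric]
      using 1 2 3 r eq(2) by blast
  qed
qed

text \<open>The condition speaks only about elements of \<open>S\<close>, and \<open>I\<close> may reach outside \<open>S\<close>: what is prime is
\<open>I \<inter> S\<close>. One set \<open>I\<close> thus serves for all rings between \<open>R\<close> and \<open>S\<close>. The equivalence for products
contains both primality and closure under multiplication by elements of \<open>S\<close>.\<close>

definition prime_ideal_in :: "'a::comm_ring_1 set \<Rightarrow> 'a set \<Rightarrow> bool" where
  "prime_ideal_in S I \<longleftrightarrow> 0 \<in> I \<and> 1 \<notin> I \<and> (\<forall>a\<in>S. \<forall>b\<in>S. (a \<in> I \<and> b \<in> I \<longrightarrow> a + b \<in> I) \<and>
     (a * b \<in> I \<longleftrightarrow> a \<in> I \<or> b \<in> I))"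

lemma prime_ideal_in_subset:
  "prime_ideal_in S I \<Longrightarrow> R \<subseteq> S \<Longrightarrow> prime_ideal_in R I"
  unfolding prime_ideal_in_def by blast

lemma prime_ideal_inD:
  assumes S: "subring S" and I: "prime_ideal_in S I"
  shows "0 \<in> I" "1 \<notin> I"
    and "a \<in> S \<Longrightarrow> b \<in> S \<Longrightarrow> a \<in> I \<Longrightarrow> b \<in> I \<Longrightarrow> a + b \<in> I"
    and "a \<in> S \<Longrightarrow> b \<in> S \<Longrightarrow> a \<in> I \<Longrightarrow> b \<in> I \<Longrightarrow> a - b \<in> I"
    and "a \<in> S \<Longrightarrow> b \<in> S \<Longrightarrow> a * b \<in> I \<longleftrightarrow> a \<in> I \<or> b \<in> I"
    and "a \<in> S \<Longrightarrow> a ^ k \<in> I \<Longrightarrow> a \<in> I"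
proof -
  note I' = I[unfolded prime_ideal_in_def]
  show "0 \<in> I" and one: "1 \<notin> I" using I' by blast+
  show plus: "a + b \<in> I" if "a \<in> S" "b \<in> S" "a \<in> I" "b \<in> I" for a b using I' that by blast
  show mult: "a * b \<in> I \<longleftrightarrow> a \<in> I \<or> b \<in> I" if "a \<in> S" "b \<in> S" for a b using I' that by blast
  show "a - b \<in> I" if ab: "a \<in> S" "b \<in> S" "a \<in> I" "b \<in> I" for a b
  proof -
    have "- 1 \<in> S" by (intro subringD[OF S])
    with mult[of "- 1" b] ab have "- 1 * b \<in> I" by blast
    then show ?thesis using plus[of a "- b"] ab subringD(6)[OF S, of b] by simp
  qed
  show "a \<in> I" if "a \<in> S" "a ^ k \<in> I" using that(2)
  proof (induction k)
    case (Suc k)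
    then show ?case using mult[of a "a ^ k"] that(1) subringD(7)[OF S that(1), of k] by auto
  qed (use one in auto)
qed

lemma prime_ideal_in_sum:
  assumes "subring S" "prime_ideal_in S I" "\<And>i. i \<in> A \<Longrightarrow> f i \<in> I \<inter> S"
  shows "sum f A \<in> I \<inter> S"
  using assms(3)
  by (induction A rule: infinite_finite_induct)
    (auto intro: prime_ideal_inD[OF assms(1,2)] subringD[OF assms(1)])

text \<open>A homomorphism from the quotient of \<open>R\<close> by \<open>I \<inter> R\<close>, presented as a function on representatives.\<close>

definition hom_mod :: "'a::comm_ring_1 set \<Rightarrow> 'a set \<Rightarrow> ('a \<Rightarrow> 'k::field) \<Rightarrow> bool" where
  "hom_mod R I \<phi> \<longleftrightarrow> \<phi> 1 = 1 \<and> (\<forall>a\<in>R. \<forall>b\<in>R. \<phi> (a + b) = \<phi> a + \<phi> b \<and> \<phi> (a * b) = \<phi> a * \<phi> b) \<and>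
     (\<forall>a\<in>R. a \<in> I \<longrightarrow> \<phi> a = 0)"

lemma hom_modD:
  assumes R: "subring R" and h: "hom_mod R I \<phi>"
  shows "\<phi> 1 = 1" "\<phi> 0 = 0"
    and "a \<in> R \<Longrightarrow> b \<in> R \<Longrightarrow> \<phi> (a + b) = \<phi> a + \<phi> b"
    and "a \<in> R \<Longrightarrow> b \<in> R \<Longrightarrow> \<phi> (a - b) = \<phi> a - \<phi> b"
    and "a \<in> R \<Longrightarrow> b \<in> R \<Longrightarrow> \<phi> (a * b) = \<phi> a * \<phi> b"
    and "a \<in> R \<Longrightarrow> \<phi> (a ^ k) = \<phi> a ^ k"
    and "a \<in> R \<Longrightarrow> a \<in> I \<Longrightarrow> \<phi> a = 0"
proof -
  note h' = h[unfolded hom_mod_def]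
  show one: "\<phi> 1 = 1" using h' by blast
  show plus: "\<phi> (a + b) = \<phi> a + \<phi> b" if "a \<in> R" "b \<in> R" for a b using h' that by blast
  show mult: "\<phi> (a * b) = \<phi> a * \<phi> b" if "a \<in> R" "b \<in> R" for a b using h' that by blast
  show "\<phi> a = 0" if "a \<in> R" "a \<in> I" using h' that by blast
  show "\<phi> 0 = 0" using plus[of 0 0] subringD(2)[OF R]
    by (metis add.right_neutral add_left_cancel)
  show "\<phi> (a - b) = \<phi> a - \<phi> b" if "a \<in> R" "b \<in> R" for a b
    using plus[of "a - b" b] subringD[OF R] that by simp
  show "\<phi> (a ^ k) = \<phi> a ^ k" if "a \<in> R"
    by (induction k) (auto simp: one mult that subringD[OF R])
qed

lemma hom_mod_sum:
  assumes R: "subring R" and h: "hom_mod R I \<phi>" and f: "\<And>i. i \<in> A \<Longrightarrow> f i \<in> R"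
  shows "\<phi> (sum f A) = (\<Sum>i\<in>A. \<phi> (f i))"
  using f
proof (induction A rule: infinite_finite_induct)
  case (insert x A)
  then show ?case
    using hom_modD(3)[OF R h, of "f x" "sum f A"] subring_sum[OF R, of A f] by simp
qed (auto simp: hom_modD[OF R h])

definition eval_hom :: "('a::comm_ring_1 \<Rightarrow> 'k::field) \<Rightarrow> 'k \<Rightarrow> 'a poly \<Rightarrow> 'k" where
  "eval_hom \<phi> \<xi> p = poly (map_poly \<phi> p) \<xi>"

lemma eval_hom:
  assumes R: "subring R" and h: "hom_mod R I \<phi>"
    and p: "p \<in> polys_over R" and q: "q \<in> polys_over R"
  shows "eval_hom \<phi> \<xi> (p + q) = eval_hom \<phi> \<xi> p + eval_hom \<phi> \<xi> q"
    and "eval_hom \<phi> \<xi> (p - q) = eval_hom \<phi> \<xi> p - eval_hom \<phi> \<xi> q"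
    and "eval_hom \<phi> \<xi> (p * q) = eval_hom \<phi> \<xi> p * eval_hom \<phi> \<xi> q"
    and "eval_hom \<phi> \<xi> [:c:] = \<phi> c"
proof -
  note H = hom_modD[OF R h]
  note pq = p[unfolded polys_over_def, simplified, rule_format] q[unfolded polys_over_def, simplified, rule_format]
  have "map_poly \<phi> (p + q) = map_poly \<phi> p + map_poly \<phi> q"
    by (rule poly_eqI) (simp add: coeff_map_poly H pq)
  then show "eval_hom \<phi> \<xi> (p + q) = eval_hom \<phi> \<xi> p + eval_hom \<phi> \<xi> q"
    by (simp add: eval_hom_def)
  have "map_poly \<phi> (p - q) = map_poly \<phi> p - map_poly \<phi> q"
    by (rule poly_eqI) (simp add: coeff_map_poly H pq)
  then show "eval_hom \<phi> \<xi> (p - q) = eval_hom \<phi> \<xi> p - eval_hom \<phi> \<xi> q"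
    by (simp add: eval_hom_def)
  have "map_poly \<phi> (p * q) = map_poly \<phi> p * map_poly \<phi> q"
    by (rule poly_eqI)
      (simp add: coeff_map_poly H pq coeff_mult hom_mod_sum[OF R h] subringD[OF R])
  then show "eval_hom \<phi> \<xi> (p * q) = eval_hom \<phi> \<xi> p * eval_hom \<phi> \<xi> q"
    by (simp add: eval_hom_def)
  show "eval_hom \<phi> \<xi> [:c:] = \<phi> c"
    by (simp add: eval_hom_def map_poly_pCons H)
qed

lemma eval_hom_eq_0:
  assumes R: "subring R" and h: "hom_mod R I \<phi>" and p: "p \<in> polys_over R" "\<forall>i. coeff p i \<in> I"
  shows "eval_hom \<phi> \<xi> p = 0"
proof -
  have "map_poly \<phi> p = 0"
    using p by (intro poly_eqI) (simp add: coeff_map_poly hom_modD[OF R h] polys_over_def)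
  then show ?thesis by (simp add: eval_hom_def)
qed

text \<open>An extension to \<open>R[x]\<close> is given by the image \<open>\<xi>\<close> of \<open>x\<close>. It is well defined modulo \<open>I\<close> as soon as
\<open>\<xi>\<close> satisfies every polynomial relation that \<open>x\<close> satisfies modulo \<open>I\<close>.\<close>

lemma hom_mod_adjoin:
  assumes R: "subring R" and h: "hom_mod R I \<phi>"
    and kill: "\<And>g. g \<in> polys_over R \<Longrightarrow> poly g x \<in> I \<Longrightarrow> eval_hom \<phi> \<xi> g = 0"
    and I0: "0 \<in> I"
  shows "\<exists>\<psi>. hom_mod (adjoin R x) I \<psi> \<and> (\<forall>g\<in>polys_over R. \<psi> (poly g x) = eval_hom \<phi> \<xi> g) \<and>
    (\<forall>c\<in>R. \<psi> c = \<phi> c)"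
proof -
  note P = subringD[OF subring_polys_over[OF R]]
  define \<psi> where "\<psi> s = eval_hom \<phi> \<xi> (SOME g. g \<in> polys_over R \<and> poly g x = s)" for s
  have \<psi>: "\<psi> (poly g x) = eval_hom \<phi> \<xi> g" if g: "g \<in> polys_over R" for g
  proof -
    define g' where "g' = (SOME g'. g' \<in> polys_over R \<and> poly g' x = poly g x)"
    have g': "g' \<in> polys_over R \<and> poly g' x = poly g x"
      unfolding g'_def by (rule someI[of _ g]) (use g in auto)
    have "eval_hom \<phi> \<xi> (g' - g) = 0"
      by (rule kill) (use g g' P I0 in auto)
    then have "eval_hom \<phi> \<xi> g' = eval_hom \<phi> \<xi> g"
      using eval_hom(2)[OF R h, of g' g] g g' by simp
    then show ?thesis by (simp add: \<psi>_def g'_def)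
  qed
  have const: "\<psi> c = \<phi> c" if "c \<in> R" for c
    using \<psi>[OF const_polys_over[OF R that]] eval_hom(4)[OF R h P(2) P(2)] by simp
  have "hom_mod (adjoin R x) I \<psi>"
    unfolding hom_mod_def
  proof (intro conjI ballI impI)
    show "\<psi> 1 = 1" using const[OF subringD(1)[OF R]] hom_modD(1)[OF R h] by simp
  next
    fix a b assume "a \<in> adjoin R x" "b \<in> adjoin R x"
    then obtain p q where p: "p \<in> polys_over R" "a = poly p x" and q: "q \<in> polys_over R" "b = poly q x"
      unfolding adjoin_def by blast
    show "\<psi> (a + b) = \<psi> a + \<psi> b"
      using \<psi>[of "p + q"] p q P eval_hom(1)[OF R h p(1) q(1)] by (simp add: \<psi>)
    show "\<psi> (a * b) = \<psi> a * \<psi> b"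
      using \<psi>[of "p * q"] p q P eval_hom(3)[OF R h p(1) q(1)] by (simp add: \<psi>)
  next
    fix a assume "a \<in> adjoin R x" "a \<in> I"
    then show "\<psi> a = 0" unfolding adjoin_def using \<psi> kill by auto
  qed
  then show ?thesis using \<psi> const by blast
qed

text \<open>If \<open>p\<close> is not constant, a root of \<open>p - 1\<close> is a place where \<open>p\<close> takes the value one.\<close>

lemma alg_closed_nonroot:
  fixes p :: "'k::alg_closed_field poly"
  assumes "p \<noteq> 0"
  shows "\<exists>z. poly p z \<noteq> 0"
proof (cases "degree p = 0")
  case True
  then show ?thesis using assms by (auto elim!: degree_eq_zeroE)
next
  case False
  have "degree (p - 1) = degree p"
    using False degree_add_eq_left[of "- 1" p] by simp
  with False obtain z where "poly (p - 1) z = 0" using alg_closed_imp_poly_has_root[of "p - 1"] by auto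
  then show ?thesis by (intro exI[of _ z]) simp
qed


text \<open>Used to remove a leading coefficient that lies in the ideal; among polynomials of minimal degree
with suitable properties modulo \<open>I\<close> this shows that the leading coefficient is nonzero modulo \<open>I\<close>.\<close>

lemma lead_coeff_strip:
  assumes "subring R" "p \<in> polys_over R" "degree p > 0"
  defines "p' \<equiv> p - monom (lead_coeff p) (degree p)"
  shows "p' \<in> polys_over R" "degree p' < degree p"
    and "poly p' x = poly p x - lead_coeff p * x ^ degree p"
    and "\<And>i. i \<noteq> degree p \<Longrightarrow> coeff p' i = coeff p i"
proof -
  show "p' \<in> polys_over R"
    unfolding p'_def using assms(2)
    by (intro subringD[OF subring_polys_over] assms monom_polys_over) (auto simp: polys_over_def)
  have "degree p' \<le> degree p"
    unfolding p'_def by (intro degree_diff_le) (auto simp: degree_monom_le)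
  moreover have "coeff p' (degree p) = 0" by (simp add: p'_def)
  ultimately show "degree p' < degree p"
    using assms(3) by (metis eq_zero_or_degree_less degree_0)
  show "poly p' x = poly p x - lead_coeff p * x ^ degree p"
    by (simp add: p'_def poly_monom)
  show "coeff p' i = coeff p i" if "i \<noteq> degree p" for i
    using that by (simp add: p'_def)
qed

lemma poly_mem_prime_ideal:
  assumes R: "subring R" and I: "prime_ideal_in (adjoin R x) I"
    and p: "p \<in> polys_over R" "\<forall>i. coeff p i \<in> I"
  shows "poly p x \<in> I"
proof -
  note S = subring_adjoin[OF R, of x]
  have "(\<Sum>i\<le>degree p. coeff p i * x ^ i) \<in> I \<inter> adjoin R x"
  proof (rule prime_ideal_in_sum[OF S I])
    fix i
    have 1: "coeff p i \<in> adjoin R x"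
      using p(1) adjoin_superset[OF R, of x] by (auto simp: polys_over_def)
    have 2: "x ^ i \<in> adjoin R x" by (intro subringD[OF S] adjoin_generator[OF R])
    show "coeff p i * x ^ i \<in> I \<inter> adjoin R x"
      using prime_ideal_inD(5)[OF S I 1 2] p(2) subringD(5)[OF S 1 2] by blast
  qed
  then show ?thesis by (simp add: poly_altdef)
qed

text \<open>\<open>f\<close> witnesses that \<open>x\<close> is algebraic over \<open>R\<close> modulo the ideal \<open>I\<close>.\<close>

definition algebraic_relation :: "'a::comm_ring_1 set \<Rightarrow> 'a set \<Rightarrow> 'a \<Rightarrow> 'a poly \<Rightarrow> bool" where
  "algebraic_relation R I x f \<longleftrightarrow> f \<in> polys_over R \<and> poly f x \<in> I \<and> (\<exists>i. coeff f i \<notin> I)"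

text \<open>A transcendental \<open>x\<close> may be sent to any \<open>\<xi>\<close>. If \<open>b = h(x)\<close>, it suffices that \<open>\<xi>\<close> is not a root of
the image of \<open>h\<close>, and such \<open>\<xi>\<close> exists when some coefficient of \<open>h\<close> survives under \<open>\<phi>\<close>.\<close>

lemma extend_hom_transcendental:
  assumes R: "subring R" and I: "prime_ideal_in (adjoin R x) I"
    and tr: "\<nexists>f. algebraic_relation R I x f"
    and b: "b \<in> adjoin R x" "b \<notin> I"
  shows "\<exists>a\<in>R. a \<notin> I \<and> (\<forall>\<phi>::'a::comm_ring_1 \<Rightarrow> 'k::alg_closed_field. hom_mod R I \<phi> \<and> \<phi> a \<noteq> 0 \<longrightarrow>
    (\<exists>\<psi>. hom_mod (adjoin R x) I \<psi> \<and> (\<forall>c\<in>R. \<psi> c = \<phi> c) \<and> \<psi> b \<noteq> 0))"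
proof -
  note S = subring_adjoin[OF R, of x]
  obtain h where h: "h \<in> polys_over R" "b = poly h x"
    using b(1) unfolding adjoin_def by blast
  obtain i where i: "coeff h i \<notin> I"
    using poly_mem_prime_ideal[OF R I h(1)] b(2) h(2) by blast
  show ?thesis
  proof (intro bexI[of _ "coeff h i"] conjI allI impI)
    show "coeff h i \<notin> I" by (rule i)
    show "coeff h i \<in> R" using h(1) by (auto simp: polys_over_def)
    fix \<phi> :: "'a \<Rightarrow> 'k"
    assume \<phi>: "hom_mod R I \<phi> \<and> \<phi> (coeff h i) \<noteq> 0"
    then have "coeff (map_poly \<phi> h) i \<noteq> 0"
      using hom_modD(2)[OF R conjunct1[OF \<phi>]] by (simp add: coeff_map_poly)
    then have "map_poly \<phi> h \<noteq> 0" by auto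
    then obtain \<xi> where \<xi>: "poly (map_poly \<phi> h) \<xi> \<noteq> 0"
      using alg_closed_nonroot by blast
    have "eval_hom \<phi> \<xi> g = 0" if "g \<in> polys_over R" "poly g x \<in> I" for g
      using eval_hom_eq_0[OF R conjunct1[OF \<phi>] that(1)] tr that unfolding algebraic_relation_def by blast
    from hom_mod_adjoin[OF R conjunct1[OF \<phi>] this prime_ideal_inD(1)[OF S I]]
    obtain \<psi> where "hom_mod (adjoin R x) I \<psi>" "\<forall>g\<in>polys_over R. \<psi> (poly g x) = eval_hom \<phi> \<xi> g"
      "\<forall>c\<in>R. \<psi> c = \<phi> c" by blast
    with \<xi> h show "\<exists>\<psi>. hom_mod (adjoin R x) I \<psi> \<and> (\<forall>c\<in>R. \<psi> c = \<phi> c) \<and> \<psi> b \<noteq> 0"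
      by (auto simp: eval_hom_def)
  qed
qed

text \<open>In the algebraic case, a relation \<open>f\<close> of minimal degree plays the role of the minimal polynomial.
Its leading coefficient need not be invertible, so division is replaced by pseudo-division.\<close>

locale minimal_relation =
  fixes R I :: "'a::comm_ring_1 set" and x :: 'a and f :: "'a poly"
  assumes R: "subring R" and I: "prime_ideal_in (adjoin R x) I"
    and rel: "algebraic_relation R I x f"
    and minimal: "\<And>g. algebraic_relation R I x g \<Longrightarrow> degree f \<le> degree g"
begin

lemmas S = subring_adjoin[OF R, of x]
lemmas S_closed = subringD[OF S]
lemmas ideal = prime_ideal_inD[OF S I]
lemmas poly_closed = subringD[OF subring_polys_over[OF R]]

lemma R_sub: "c \<in> R \<Longrightarrow> c \<in> adjoin R x"
  using adjoin_superset[OF R] by blast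

lemma f_over: "f \<in> polys_over R" and f_root: "poly f x \<in> I"
  using rel by (auto simp: algebraic_relation_def)

lemma lead_mem: "p \<in> polys_over R \<Longrightarrow> lead_coeff p \<in> R"
  by (simp add: polys_over_def)

lemma lead_mem_adjoin: "p \<in> polys_over R \<Longrightarrow> lead_coeff p \<in> adjoin R x"
  by (intro R_sub lead_mem)

lemmas ideal_closed = ideal(1,3,4)
lemmas mem = S_closed(3-7) lead_mem_adjoin poly_in_adjoin adjoin_generator[OF R]

lemma small_relation_trivial:
  assumes "g \<in> polys_over R" "poly g x \<in> I" "degree g < degree f"
  shows "\<forall>i. coeff g i \<in> I"
  using minimal[of g] assms unfolding algebraic_relation_def by fastforce

lemma degree_pos: "degree f > 0"
proof (rule ccontr)
  assume "\<not> degree f > 0"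
  then have deg: "degree f = 0" by simp
  then obtain c where f: "f = [:c:]" by (rule degree_eq_zeroE)
  then have "c \<in> I" using f_root by simp
  then have "\<forall>i. coeff f i \<in> I" by (auto simp: f coeff_pCons ideal split: nat.split)
  then show False using rel by (auto simp: algebraic_relation_def)
qed

lemma lead_notin: "lead_coeff f \<notin> I"
proof
  assume lc: "lead_coeff f \<in> I"
  define f' where "f' = f - monom (lead_coeff f) (degree f)"
  note f' = lead_coeff_strip[OF R f_over degree_pos, folded f'_def]
  have "lead_coeff f * x ^ degree f \<in> I"
    using ideal(5)[OF lead_mem_adjoin[OF f_over] S_closed(7)[OF adjoin_generator[OF R]]] lc by blast
  then have "poly f' x \<in> I"
    unfolding f'(3)
    by (intro ideal_closed f_root mem f_over)
  from small_relation_trivial[OF f'(1) this f'(2)] f'(4) lc have "\<forall>i. coeff f i \<in> I"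
    by metis
  then show False using rel by (auto simp: algebraic_relation_def)
qed

text \<open>Up to a power of the leading coefficient, \<open>f\<close> divides every relation modulo \<open>I\<close>, because the
remainder is a relation of smaller degree. So a root of the image of \<open>f\<close> is a root of the image of
every relation, provided that \<open>\<phi>\<close> does not kill the leading coefficient.\<close>

lemma kill_by_root:
  assumes \<phi>: "hom_mod R I \<phi>" and a: "\<phi> (lead_coeff f) \<noteq> 0" and \<xi>: "eval_hom \<phi> \<xi> f = 0"
    and g: "g \<in> polys_over R" "poly g x \<in> I"
  shows "eval_hom \<phi> \<xi> g = 0"
proof -
  define c where "c = lead_coeff f"
  have c: "c \<in> R" unfolding c_def by (rule lead_mem[OF f_over])
  obtain k q r where q: "q \<in> polys_over R" and r: "r \<in> polys_over R"
    and eq: "smult (c ^ k) g = q * f + r" and deg: "degree r < degree f"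
    using pseudo_division_over_subring[OF R f_over degree_pos g(1)] unfolding c_def by blast
  have "poly r x = c ^ k * poly g x - poly q x * poly f x"
    using arg_cong[OF eq, of "\<lambda>p. poly p x"] by simp
  moreover have "c ^ k * poly g x \<in> I"
    using ideal(5)[OF S_closed(7)[OF R_sub[OF c]] poly_in_adjoin[OF g(1)]] g(2) by blast
  moreover have "poly q x * poly f x \<in> I"
    using ideal(5)[OF poly_in_adjoin[OF q] poly_in_adjoin[OF f_over]] f_root by blast
  ultimately have "poly r x \<in> I"
    using ideal(4) S_closed(5,7) R_sub[OF c] poly_in_adjoin q f_over g(1) by metis
  then have r0: "eval_hom \<phi> \<xi> r = 0"
    using small_relation_trivial[OF r _ deg] eval_hom_eq_0[OF R \<phi> r] by blast
  have ck: "[:c ^ k:] \<in> polys_over R" by (intro const_polys_over[OF R] subringD[OF R] c)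
  have "\<phi> c ^ k * eval_hom \<phi> \<xi> g = eval_hom \<phi> \<xi> ([:c ^ k:] * g)"
    using eval_hom(3)[OF R \<phi> ck g(1)] eval_hom(4)[OF R \<phi> ck ck] hom_modD(6)[OF R \<phi> c] by simp
  also have "[:c ^ k:] * g = q * f + r" using eq by simp
  also have "eval_hom \<phi> \<xi> (q * f + r) = 0"
    using eval_hom(1)[OF R \<phi> poly_closed(5)[OF q f_over] r] eval_hom(3)[OF R \<phi> q f_over] \<xi> r0 by simp
  finally show ?thesis using a by (simp add: c_def)
qed

text \<open>Over the fraction field of \<open>R\<close> modulo \<open>I\<close> the element \<open>b\<close> would have an inverse; clearing
denominators, \<open>b\<close> divides a nonzero constant \<open>c\<close>. To find \<open>c\<close>, take a polynomial \<open>d\<close> of minimal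
degree whose value \<open>d(x)\<close> is nonzero and a multiple of \<open>b\<close>, modulo \<open>I\<close>. It has smaller degree than
\<open>f\<close>. If it were not constant, dividing \<open>f\<close> by \<open>d\<close> would leave a zero remainder modulo \<open>I\<close>, hence
\<open>q(x) d(x) = 0\<close> and so \<open>q(x) = 0\<close> with \<open>q\<close> of smaller degree than \<open>f\<close>, which makes \<open>q\<close> vanish
modulo \<open>I\<close>, and with it the leading coefficient of \<open>f\<close>.\<close>

lemma divides_constant:
  assumes b: "b \<in> adjoin R x" "b \<notin> I"
  shows "\<exists>c\<in>R. \<exists>u\<in>adjoin R x. c \<notin> I \<and> c - u * b \<in> I"
proof -
  define D where "D d \<longleftrightarrow> d \<in> polys_over R \<and> poly d x \<notin> I \<and> (\<exists>u\<in>adjoin R x. poly d x - u * b \<in> I)" for d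
  obtain h where h: "h \<in> polys_over R" "b = poly h x"
    using b(1) unfolding adjoin_def by blast
  have "D h" unfolding D_def using h b ideal(1) S_closed(1) by (auto intro!: bexI[of _ 1])
  then obtain d where d: "D d" and dmin: "\<And>e. D e \<Longrightarrow> degree d \<le> degree e"
    by (metis arg_min_nat_lemma)
  obtain u where dR: "d \<in> polys_over R" and dx: "poly d x \<notin> I" and u: "u \<in> adjoin R x" "poly d x - u * b \<in> I"
    using d unfolding D_def by blast
  note mem = mem dR f_over u(1) b(1)
  have dub: "poly d x - u * b \<in> adjoin R x" by (intro mem)
  \<comment> \<open>Otherwise the remainder of \<open>d\<close> modulo \<open>f\<close> would be a smaller candidate.\<close>
  have deg_d: "degree d < degree f"
  proof -
    define c where "c = lead_coeff f"
    obtain k q r where q: "q \<in> polys_over R" and r: "r \<in> polys_over R"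
      and eq: "smult (c ^ k) d = q * f + r" and deg: "degree r < degree f"
      using pseudo_division_over_subring[OF R f_over degree_pos dR] unfolding c_def by blast
    have c: "c \<in> adjoin R x" "c \<notin> I" unfolding c_def using lead_notin lead_mem_adjoin[OF f_over] by auto
    have ck: "c ^ k \<in> adjoin R x" "c ^ k \<notin> I" using ideal(6)[OF c(1), of k] c(2) S_closed(7)[OF c(1)] by auto
    have rx: "c ^ k * poly d x = poly q x * poly f x + poly r x"
      using arg_cong[OF eq, of "\<lambda>p. poly p x"] by simp
    have qf: "poly q x * poly f x \<in> I"
      using ideal(5)[OF poly_in_adjoin[OF q] poly_in_adjoin[OF f_over]] f_root by blast
    have "poly r x \<notin> I"
    proof
      assume "poly r x \<in> I"
      then have "c ^ k * poly d x \<in> I" unfolding rx using qf by (intro ideal_closed mem q r)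
      then show False using ideal(5)[OF ck(1) poly_in_adjoin[OF dR]] ck(2) dx by blast
    qed
    moreover have "c ^ k * (poly d x - u * b) \<in> I"
      using ideal(5)[OF ck(1) dub] u(2) by blast
    then have "c ^ k * (poly d x - u * b) - poly q x * poly f x \<in> I"
      using qf by (intro ideal_closed mem q ck)
    then have "poly r x - (c ^ k * u) * b \<in> I"
      using rx by (simp add: algebra_simps)
    ultimately have "D r" unfolding D_def using r S_closed(5)[OF ck(1) u(1)] by blast
    then show ?thesis using dmin[of r] deg by simp
  qed
  have "degree d = 0"
  proof (rule ccontr)
    assume "degree d \<noteq> 0"
    then have dpos: "degree d > 0" by simp
    define c where "c = lead_coeff d"
    have c: "c \<in> adjoin R x" unfolding c_def by (intro mem)
    \<comment> \<open>Otherwise \<open>d\<close> without its leading term would be a smaller candidate.\<close>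
    have cI: "c \<notin> I"
    proof
      assume cI: "c \<in> I"
      define d' where "d' = d - monom (lead_coeff d) (degree d)"
      note d' = lead_coeff_strip[OF R dR dpos, folded d'_def, folded c_def]
      have xk: "x ^ degree d \<in> adjoin R x" by (intro S_closed adjoin_generator[OF R])
      have cx: "c * x ^ degree d \<in> I"
        using ideal(5)[OF c xk] cI by blast
      have "poly d' x \<notin> I"
      proof
        assume "poly d' x \<in> I"
        then have "poly d' x + c * x ^ degree d \<in> I"
          using cx by (intro ideal_closed mem d' c xk)
        then show False using dx by (simp add: d'(3))
      qed
      moreover have "(poly d x - u * b) - c * x ^ degree d \<in> I"
        using ideal(4)[OF dub S_closed(5)[OF c xk] u(2) cx] .
      then have "poly d' x - u * b \<in> I" by (simp add: d'(3) algebra_simps)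
      ultimately have "D d'" unfolding D_def using d'(1) u(1) by blast
      then show False using dmin[of d'] d'(2) by simp
    qed
    obtain k q r where q: "q \<in> polys_over R" and r: "r \<in> polys_over R"
      and eq: "smult (c ^ k) f = q * d + r" and deg: "degree r < degree d"
      and degq: "degree q \<le> degree f - degree d"
      using pseudo_division_over_subring[OF R dR dpos f_over] unfolding c_def by blast
    have ck: "c ^ k \<in> adjoin R x" "c ^ k \<notin> I" using ideal(6)[OF c, of k] cI S_closed(7)[OF c] by auto
    have rx: "c ^ k * poly f x = poly q x * poly d x + poly r x"
      using arg_cong[OF eq, of "\<lambda>p. poly p x"] by simp
    have cf: "c ^ k * poly f x \<in> I" using ideal(5)[OF ck(1) poly_in_adjoin[OF f_over]] f_root by blast
    have qd: "poly q x * (poly d x - u * b) \<in> I"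
      using ideal(5)[OF poly_in_adjoin[OF q] dub] u(2) by blast
    have "c ^ k * poly f x - poly q x * (poly d x - u * b) \<in> I"
      using cf qd by (intro ideal_closed mem q ck)
    then have rI: "poly r x - (- poly q x * u) * b \<in> I"
      using rx by (simp add: algebra_simps)
    have "- poly q x * u \<in> adjoin R x" by (intro mem q)
    with rI r have "poly r x \<notin> I \<Longrightarrow> D r" unfolding D_def by blast
    then have rI: "poly r x \<in> I" using dmin[of r] deg by fastforce
    then have "c ^ k * poly f x - poly r x \<in> I" using cf by (intro ideal_closed mem q r ck)
    then have "poly q x * poly d x \<in> I" using rx by (simp add: algebra_simps)
    then have "poly q x \<in> I" using ideal(5)[OF poly_in_adjoin[OF q] poly_in_adjoin[OF dR]] dx by blast
    then have qi: "\<forall>i. coeff q i \<in> I"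
      using degq dpos deg_d by (intro small_relation_trivial q) auto
    have ri: "\<forall>i. coeff r i \<in> I"
      using deg deg_d rI by (intro small_relation_trivial r) auto
    have coef: "coeff p i \<in> adjoin R x" if "p \<in> polys_over R" for p i
      using that R_sub by (auto simp: polys_over_def)
    \<comment> \<open>Comparing coefficients in \<open>c ^ k * f = q * d + r\<close> puts the leading coefficient of \<open>f\<close> into \<open>I\<close>.\<close>
    have "coeff (q * d) (degree f) \<in> I \<inter> adjoin R x"
      unfolding coeff_mult
    proof (rule prime_ideal_in_sum[OF S I])
      fix i
      show "coeff q i * coeff d (degree f - i) \<in> I \<inter> adjoin R x"
        using ideal(5)[OF coef[OF q] coef[OF dR]] qi S_closed(5)[OF coef[OF q] coef[OF dR]] by blast
    qed
    then have "coeff (q * d) (degree f) + coeff r (degree f) \<in> I"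
      using ri by (intro ideal(3) coef[OF r]) auto
    then have "c ^ k * lead_coeff f \<in> I"
      using arg_cong[OF eq, of "\<lambda>p. coeff p (degree f)"] by simp
    then show False
      using ideal(5)[OF ck(1) coef[OF f_over]] ck(2) lead_notin by blast
  qed
  then obtain c where c: "d = [:c:]" by (rule degree_eq_zeroE)
  then have "c \<in> R" using dR by (auto simp: polys_over_def dest: spec[of _ 0])
  with c dx u show ?thesis by auto
qed

text \<open>The element \<open>a\<close> is the product of two constants: the leading coefficient of \<open>f\<close>, which must survive
so that the image of \<open>f\<close> has a root, and a multiple \<open>c\<close> of \<open>b\<close>, which must survive so that \<open>b\<close> does.\<close>

lemma extend_hom_algebraic:
  assumes b: "b \<in> adjoin R x" "b \<notin> I"
  shows "\<exists>a\<in>R. a \<notin> I \<and> (\<forall>\<phi>::'a \<Rightarrow> 'k::alg_closed_field. hom_mod R I \<phi> \<and> \<phi> a \<noteq> 0 \<longrightarrow>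
    (\<exists>\<psi>. hom_mod (adjoin R x) I \<psi> \<and> (\<forall>c\<in>R. \<psi> c = \<phi> c) \<and> \<psi> b \<noteq> 0))"
proof -
  obtain c u where c: "c \<in> R" "c \<notin> I" and u: "u \<in> adjoin R x" "c - u * b \<in> I"
    using divides_constant[OF b] by blast
  define a where "a = lead_coeff f"
  have a: "a \<in> R" "a \<notin> I" unfolding a_def using lead_notin lead_mem[OF f_over] by auto
  show ?thesis
  proof (intro bexI[of _ "a * c"] conjI allI impI)
    show "a * c \<notin> I" using ideal(5)[OF R_sub[OF a(1)] R_sub[OF c(1)]] a(2) c(2) by blast
    show "a * c \<in> R" using a c by (intro subringD[OF R])
    fix \<phi> :: "'a \<Rightarrow> 'k"
    assume "hom_mod R I \<phi> \<and> \<phi> (a * c) \<noteq> 0"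
    then have \<phi>: "hom_mod R I \<phi>" and nz: "\<phi> a \<noteq> 0" "\<phi> c \<noteq> 0"
      using hom_modD(5)[OF R, of I \<phi> a c] a c by auto
    have "coeff (map_poly \<phi> f) (degree f) \<noteq> 0"
      using nz by (simp add: coeff_map_poly hom_modD(2)[OF R \<phi>] a_def)
    then have "degree (map_poly \<phi> f) > 0"
      using degree_pos le_degree by fastforce
    then obtain \<xi> where "eval_hom \<phi> \<xi> f = 0"
      using alg_closed_imp_poly_has_root unfolding eval_hom_def by blast
    from hom_mod_adjoin[OF R \<phi> kill_by_root[OF \<phi> nz(1)[unfolded a_def] this] ideal(1)]
    obtain \<psi> where \<psi>: "hom_mod (adjoin R x) I \<psi>" and ext: "\<forall>c\<in>R. \<psi> c = \<phi> c" by blast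
    have "\<psi> b \<noteq> 0"
    proof
      assume "\<psi> b = 0"
      have ub: "u * b \<in> adjoin R x" using u b by (intro S_closed)
      have "\<psi> (c - u * b) = \<psi> c - \<psi> u * \<psi> b"
        using hom_modD(4)[OF S \<psi> R_sub[OF c(1)] ub] hom_modD(5)[OF S \<psi> u(1) b(1)] by simp
      moreover have "\<psi> (c - u * b) = 0"
        using u(2) by (intro hom_modD(7)[OF S \<psi>] S_closed ub R_sub c)
      ultimately show False using nz ext c \<open>\<psi> b = 0\<close> by auto
    qed
    then show "\<exists>\<psi>. hom_mod (adjoin R x) I \<psi> \<and> (\<forall>c\<in>R. \<psi> c = \<phi> c) \<and> \<psi> b \<noteq> 0"
      using \<psi> ext by blast
  qed
qed

end

lemma extend_hom_step:
  assumes R: "subring R" and I: "prime_ideal_in (adjoin R x) I"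
    and b: "b \<in> adjoin R x" "b \<notin> I"
  shows "\<exists>a\<in>R. a \<notin> I \<and> (\<forall>\<phi>::'a::comm_ring_1 \<Rightarrow> 'k::alg_closed_field. hom_mod R I \<phi> \<and> \<phi> a \<noteq> 0 \<longrightarrow>
    (\<exists>\<psi>. hom_mod (adjoin R x) I \<psi> \<and> (\<forall>c\<in>R. \<psi> c = \<phi> c) \<and> \<psi> b \<noteq> 0))"
proof (cases "\<exists>f. algebraic_relation R I x f")
  case False
  then show ?thesis by (rule extend_hom_transcendental[OF R I _ b])
next
  case True
  then obtain f where "algebraic_relation R I x f"
    "\<And>g. algebraic_relation R I x g \<Longrightarrow> degree f \<le> degree g"
    by (metis arg_min_nat_lemma)
  then interpret minimal_relation R I x f
    using R I by unfold_locales
  show ?thesis by (rule extend_hom_algebraic[OF b])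
qed

definition adjoin_list :: "'a::comm_ring_1 set \<Rightarrow> 'a list \<Rightarrow> 'a set" where
  "adjoin_list R xs = fold (\<lambda>x R. adjoin R x) xs R"

lemma adjoin_list_simps [simp]:
  "adjoin_list R [] = R" "adjoin_list R (x # xs) = adjoin_list (adjoin R x) xs"
  by (simp_all add: adjoin_list_def)

lemma adjoin_list:
  assumes "subring R"
  shows "subring (adjoin_list R xs)" "R \<subseteq> adjoin_list R xs" "set xs \<subseteq> adjoin_list R xs"
proof -
  have "subring (adjoin_list R xs) \<and> R \<subseteq> adjoin_list R xs \<and> set xs \<subseteq> adjoin_list R xs"
    using assms
  proof (induction xs arbitrary: R)
    case (Cons x xs)
    from Cons.IH[OF subring_adjoin[OF Cons.prems, of x]]
      adjoin_superset[OF Cons.prems, of x] adjoin_generator[OF Cons.prems, of x]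
    show ?case by auto
  qed auto
  then show "subring (adjoin_list R xs)" "R \<subseteq> adjoin_list R xs" "set xs \<subseteq> adjoin_list R xs"
    by auto
qed

lemma adjoin_list_least:
  assumes Q: "subring Q" and "R \<subseteq> Q" "set xs \<subseteq> Q"
  shows "adjoin_list R xs \<subseteq> Q"
  using assms(2,3)
proof (induction xs arbitrary: R)
  case (Cons x xs)
  have "adjoin R x \<subseteq> Q"
  proof
    fix a assume "a \<in> adjoin R x"
    then obtain p where p: "\<And>i. coeff p i \<in> R" "a = poly p x"
      by (auto simp: adjoin_def polys_over_def)
    show "a \<in> Q"
      unfolding p(2) poly_altdef
      using Cons.prems p(1) by (intro subring_sum[OF Q] subringD[OF Q]) auto
  qed
  with Cons show ?case by simp
qed simp

text \<open>Induction on the number of generators. This is why the one-step lemma has to preserve that a given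
element is nonzero: the \<open>a'\<close> obtained for the upper extension takes the place of \<open>b\<close> in the lower one.\<close>

lemma extend_hom:
  assumes R: "subring R" and I: "prime_ideal_in (adjoin_list R xs) I"
    and b: "b \<in> adjoin_list R xs" "b \<notin> I"
  shows "\<exists>a\<in>R. a \<notin> I \<and> (\<forall>\<phi>::'a::comm_ring_1 \<Rightarrow> 'k::alg_closed_field. hom_mod R I \<phi> \<and> \<phi> a \<noteq> 0 \<longrightarrow>
    (\<exists>\<psi>. hom_mod (adjoin_list R xs) I \<psi> \<and> (\<forall>c\<in>R. \<psi> c = \<phi> c) \<and> \<psi> b \<noteq> 0))"
  using assms
proof (induction xs arbitrary: R)
  case Nil
  then show ?case by auto
next
  case (Cons x xs)
  let ?R = "adjoin R x"
  have R': "subring ?R" using Cons.prems(1) by (rule subring_adjoin)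
  from Cons.IH[OF R'] Cons.prems obtain a' where a': "a' \<in> ?R" "a' \<notin> I"
    "\<And>\<phi>::'a \<Rightarrow> 'k. hom_mod ?R I \<phi> \<Longrightarrow> \<phi> a' \<noteq> 0 \<Longrightarrow>
      \<exists>\<psi>. hom_mod (adjoin_list ?R xs) I \<psi> \<and> (\<forall>c\<in>?R. \<psi> c = \<phi> c) \<and> \<psi> b \<noteq> 0"
    by auto
  have "prime_ideal_in ?R I"
    using Cons.prems(2) adjoin_list(2)[OF R', of xs] by (auto intro: prime_ideal_in_subset)
  from extend_hom_step[OF Cons.prems(1) this a'(1,2)] obtain a where a: "a \<in> R" "a \<notin> I"
    "\<And>\<phi>::'a \<Rightarrow> 'k. hom_mod R I \<phi> \<Longrightarrow> \<phi> a \<noteq> 0 \<Longrightarrow>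
      \<exists>\<psi>. hom_mod ?R I \<psi> \<and> (\<forall>c\<in>R. \<psi> c = \<phi> c) \<and> \<psi> a' \<noteq> 0"
    by auto
  have "\<exists>\<psi>. hom_mod (adjoin_list ?R xs) I \<psi> \<and> (\<forall>c\<in>R. \<psi> c = \<phi> c) \<and> \<psi> b \<noteq> 0"
    if "hom_mod R I \<phi>" "\<phi> a \<noteq> 0" for \<phi> :: "'a \<Rightarrow> 'k"
    using a(3)[OF that] a'(3) adjoin_superset[OF Cons.prems(1), of x] by (metis subset_eq)
  with a(1,2) show ?case by auto
qed

section \<open>The lattice of columns\<close>
definition column :: "nat list \<Rightarrow> bool" where
  "column xs \<longleftrightarrow> xs \<noteq> [] \<and> sorted_wrt (<) xs \<and> 0 \<notin> set xs"

definition column_tableau :: "nat list \<Rightarrow> tableau" where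
  "column_tableau xs = Tableau (map (\<lambda>x. [x]) xs)"

lemma rows_column_tableau:
  assumes "column xs"
  shows "rows (column_tableau xs) = map (\<lambda>x. [x]) xs"
proof -
  have "ssyt (map (\<lambda>x. [x]) xs)"
    using assms by (auto simp: column_def ssyt_def sorted_wrt_map above_def intro!: gr0I)
  then show ?thesis by (simp add: column_tableau_def Tableau_inverse)
qed

text \<open>Columns are strictly increasing lists. A column behaves as if it continued with infinite entries,
so the meet is as long as the longer column, and the join is as long as the shorter one.\<close>

fun meet :: "nat list \<Rightarrow> nat list \<Rightarrow> nat list" where
  "meet [] ys = ys"
| "meet xs [] = xs"
| "meet (x # xs) (y # ys) = min x y # meet xs ys"

fun join :: "nat list \<Rightarrow> nat list \<Rightarrow> nat list" where
  "join (x # xs) (y # ys) = max x y # join xs ys"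
| "join _ _ = []"

fun col_le :: "nat list \<Rightarrow> nat list \<Rightarrow> bool" where
  "col_le xs [] \<longleftrightarrow> True"
| "col_le [] (y # ys) \<longleftrightarrow> False"
| "col_le (x # xs) (y # ys) \<longleftrightarrow> x \<le> y \<and> col_le xs ys"

lemma col_le_trans: "col_le xs ys \<Longrightarrow> col_le ys zs \<Longrightarrow> col_le xs zs"
proof (induction ys zs arbitrary: xs rule: col_le.induct)
  case (3 y ys z zs)
  then show ?case by (cases xs) auto
qed auto

lemma col_le_refl: "col_le xs xs"
  by (induction xs) auto

lemma col_le_iff_nth:
  "col_le xs ys \<longleftrightarrow> length ys \<le> length xs \<and> (\<forall>i<length ys. xs ! i \<le> ys ! i)"
  by (induction xs ys rule: col_le.induct) (auto simp: nth_Cons' less_Suc_eq_0_disj)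

lemma col_le_meet1: "col_le (meet xs ys) xs"
  by (induction xs ys rule: meet.induct) (auto simp: col_le_refl)

lemma col_le_meet2: "col_le (meet xs ys) ys"
  by (induction xs ys rule: meet.induct) (auto simp: col_le_refl)

lemma col_le_meetI: "col_le zs xs \<Longrightarrow> col_le zs ys \<Longrightarrow> col_le zs (meet xs ys)"
proof (induction xs ys arbitrary: zs rule: meet.induct)
  case (3 x xs y ys)
  then show ?case by (cases zs) auto
qed auto

lemma col_le_join: "col_le xs (join xs ys)"
  by (induction xs ys rule: join.induct) auto

lemma set_meet: "set (meet xs ys) \<subseteq> set xs \<union> set ys"
  by (induction xs ys rule: meet.induct) auto

lemma set_join: "set (join xs ys) \<subseteq> {max x y | x y. x \<in> set xs \<and> y \<in> set ys}"
  by (induction xs ys rule: join.induct) fastforce+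

lemma column_meet:
  assumes "column xs" "column ys"
  shows "column (meet xs ys)"
proof -
  have "sorted_wrt (<) (meet xs ys)" if "sorted_wrt (<) xs" "sorted_wrt (<) ys"
    using that
  proof (induction xs ys rule: meet.induct)
    case (3 x xs y ys)
    then show ?case using set_meet[of xs ys] by fastforce
  qed auto
  moreover have "meet xs ys \<noteq> []" using assms by (cases "(xs, ys)" rule: meet.cases) (auto simp: column_def)
  ultimately show ?thesis using assms set_meet[of xs ys] by (auto simp: column_def)
qed

lemma column_join:
  assumes "column xs" "column ys"
  shows "column (join xs ys)"
proof -
  have "sorted_wrt (<) (join xs ys)" if "sorted_wrt (<) xs" "sorted_wrt (<) ys"
    using that
  proof (induction xs ys rule: join.induct)
    case (1 x xs y ys)
    then show ?case using set_join[of xs ys] by fastforce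
  qed auto
  moreover have "join xs ys \<noteq> []" using assms by (cases "(xs, ys)" rule: join.cases) (auto simp: column_def)
  moreover have "0 \<notin> set (join xs ys)"
    using assms set_join[of xs ys] unfolding column_def by (fastforce simp: max_def split: if_splits)
  ultimately show ?thesis using assms by (auto simp: column_def)
qed

text \<open>Row by row, both sides contain the same one or two entries, in sorted order.\<close>

lemma star_rows_meet_join:
  "star_rows (map (\<lambda>x. [x]) (meet xs ys)) (map (\<lambda>x. [x]) (join xs ys)) =
   star_rows (map (\<lambda>x. [x]) xs) (map (\<lambda>x. [x]) ys)"
  by (induction xs ys rule: meet.induct) (auto simp: min_def max_def)

lemma meet_plus_join:
  assumes "column xs" "column ys"
  shows "column_tableau (meet xs ys) + column_tableau (join xs ys) =
    column_tableau xs + column_tableau ys"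
  using assms column_meet[OF assms] column_join[OF assms]
  by (simp add: plus_tableau.rep_eq rows_column_tableau star_rows_meet_join flip: rows_inject)

text \<open>Straightening: \<open>c\<close> travels through the chain, each time leaving the meet behind and carrying the
join along.\<close>

fun insert_column :: "nat list \<Rightarrow> nat list list \<Rightarrow> nat list list" where
  "insert_column c [] = [c]"
| "insert_column c (d # ds) = meet c d # insert_column (join c d) ds"

lemma col_le_insert_column:
  "col_le z c \<Longrightarrow> \<forall>d\<in>set ds. col_le z d \<Longrightarrow> \<forall>e\<in>set (insert_column c ds). col_le z e"
proof (induction c ds rule: insert_column.induct)
  case (2 c d ds)
  then show ?case using col_le_meetI col_le_trans[OF _ col_le_join] by auto
qed auto

text \<open>The new first column \<open>meet c d\<close> is below the carried column \<open>join c d\<close> and, as it is below \<open>d\<close>,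
also below the rest of the chain. Hence \<open>col_le_insert_column\<close> applies.\<close>

lemma sorted_insert_column:
  "sorted_wrt col_le ds \<Longrightarrow> sorted_wrt col_le (insert_column c ds)"
proof (induction c ds rule: insert_column.induct)
  case (2 c d ds)
  have "\<forall>e\<in>set (insert_column (join c d) ds). col_le (meet c d) e"
  proof (rule col_le_insert_column)
    show "col_le (meet c d) (join c d)"
      using col_le_trans[OF col_le_meet1 col_le_join] .
    show "\<forall>e\<in>set ds. col_le (meet c d) e"
      using 2(2) col_le_trans[OF col_le_meet2] by auto
  qed
  then show ?case using 2 by simp
qed auto

definition columns_sum :: "nat list list \<Rightarrow> tableau" where
  "columns_sum cs = sum_list (map column_tableau cs)"

lemma columns_sum_simps [simp]:
  "columns_sum [] = 0"
  "columns_sum (c # cs) = column_tableau c + columns_sum cs"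
  "columns_sum (cs @ ds) = columns_sum cs + columns_sum ds"
  by (simp_all add: columns_sum_def)

lemma columns_sum_insert_column:
  "column c \<Longrightarrow> \<forall>d\<in>set ds. column d \<Longrightarrow> columns_sum (insert_column c ds) = column_tableau c + columns_sum ds"
proof (induction c ds rule: insert_column.induct)
  case (2 c d ds)
  then show ?case
    using meet_plus_join[of c d] by (simp add: column_join add.assoc[symmetric])
qed auto

section \<open>Uniqueness of chains\<close>

text \<open>A tableau is determined by the multisets of entries of its rows, and these turn the monoid operation
into addition of multisets. This embeds the monoid of tableaux into a cancellative one.\<close>

definition row_content :: "tableau \<Rightarrow> nat \<Rightarrow> nat multiset" where
  "row_content T i = (if i < length (rows T) then mset (rows T ! i) else {#})"

lemma row_content_plus: "row_content (S + T) i = row_content S i + row_content T i"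
proof -
  have "(if i < length (star_rows S T) then mset (star_rows S T ! i) else {#}) =
    (if i < length S then mset (S ! i) else {#}) + (if i < length T then mset (T ! i) else {#})" for S T
  proof (induction S T arbitrary: i rule: star_rows.induct)
    case (3 r S s T)
    show ?case
    proof (cases i)
      case (Suc k)
      then show ?thesis using 3[of k] unfolding Suc by (simp split del: if_split cong: if_cong)
    qed simp
  qed simp_all
  then show ?thesis unfolding row_content_def plus_tableau.rep_eq .
qed

lemma row_content_inject:
  assumes "row_content S = row_content T"
  shows "S = T"
proof -
  have nth: "i < length (rows U) \<Longrightarrow> rows U ! i \<noteq> [] \<and> sorted (rows U ! i)" for U i
    using rows[of U] by (auto simp: ssyt_def)
  have nonempty: "i < length (rows U) \<longleftrightarrow> row_content U i \<noteq> {#}" for U i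
    using nth[of i U] by (auto simp: row_content_def)
  have iff: "i < length (rows S) \<longleftrightarrow> i < length (rows T)" for i
    using assms by (simp add: nonempty)
  then have len: "length (rows S) = length (rows T)"
    by (meson linorder_neqE_nat nat_neq_iff)
  have "rows S = rows T"
  proof (rule nth_equalityI[OF len])
    fix i assume i: "i < length (rows S)"
    then have "mset (rows S ! i) = mset (rows T ! i)"
      using fun_cong[OF assms, of i] iff by (simp add: row_content_def)
    then show "rows S ! i = rows T ! i"
      using nth[OF i] nth[of i T] iff i by (metis properties_for_sort sorted_sort_id)
  qed
  then show ?thesis by (simp add: rows_inject)
qed

lemma tableau_add_left_cancel:
  fixes S T U :: tableau
  assumes "S + T = S + U"
  shows "T = U"
proof (rule row_content_inject, rule ext)
  fix i
  show "row_content T i = row_content U i"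
    using arg_cong[OF assms, of "\<lambda>T. row_content T i"] by (simp add: row_content_plus)
qed

lemma row_content_column_tableau:
  "column c \<Longrightarrow> row_content (column_tableau c) i = (if i < length c then {#c ! i#} else {#})"
  by (simp add: row_content_def rows_column_tableau)

lemma row_content_zero: "row_content 0 i = {#}"
  by (simp add: row_content_def zero_tableau.rep_eq)

lemma row_content_chain:
  assumes "\<forall>d\<in>set ds. column d \<and> col_le c d"
  shows "y \<in># row_content (columns_sum ds) i \<Longrightarrow> i < length c \<and> c ! i \<le> y"
  using assms
  by (induction ds)
    (auto simp: row_content_zero row_content_plus row_content_column_tableau col_le_iff_nth split: if_splits)

text \<open>The first column of a chain holds in each row the least entry of that row of the sum. So chains with
equal sums have equal first columns, which can be cancelled.\<close>

lemma chain_unique: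
  assumes "\<forall>d\<in>set cs. column d" "sorted_wrt col_le cs" "\<forall>d\<in>set ds. column d" "sorted_wrt col_le ds"
    and "columns_sum cs = columns_sum ds"
  shows "cs = ds"
  using assms
proof (induction cs arbitrary: ds)
  have nonzero: "columns_sum (d # ds) \<noteq> 0" if "column d" for d ds
  proof
    assume "columns_sum (d # ds) = 0"
    from arg_cong[OF this, of "\<lambda>T. row_content T 0"] that show False
      by (simp add: row_content_plus row_content_zero row_content_column_tableau column_def)
  qed
  {
    case Nil
    then show ?case using nonzero by (cases ds) force+
  next
    case (Cons c cs)
    obtain d ds' where ds: "ds = d # ds'"
      using Cons.prems nonzero[of c cs] by (cases ds) auto
    have c: "column c" and d: "column d" using Cons.prems ds by auto
    have eq: "row_content (column_tableau c) i + row_content (columns_sum cs) i =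
      row_content (column_tableau d) i + row_content (columns_sum ds') i" for i
      using arg_cong[OF Cons.prems(5), of "\<lambda>T. row_content T i"] by (simp add: ds row_content_plus)
    have 1: "i < length d \<and> d ! i \<le> c ! i" if "i < length c" for i
    proof -
      have "c ! i \<in># row_content (column_tableau d) i + row_content (columns_sum ds') i"
        unfolding eq[of i, symmetric] using that by (simp add: row_content_column_tableau[OF c])
      then show ?thesis
        using row_content_chain[of ds' d "c ! i" i] Cons.prems ds d
        by (auto simp: row_content_column_tableau split: if_splits)
    qed
    have 2: "i < length c \<and> c ! i \<le> d ! i" if "i < length d" for i
    proof -
      have "d ! i \<in># row_content (column_tableau c) i + row_content (columns_sum cs) i"
        unfolding eq using that by (simp add: row_content_column_tableau[OF d])
      then show ?thesis
        using row_content_chain[of cs c "d ! i" i] Cons.prems c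
        by (auto simp: row_content_column_tableau split: if_splits)
    qed
    have "length c = length d" using 1 2 by (meson linorder_neqE_nat nat_neq_iff)
    then have "c = d" using 1 2 by (intro nth_equalityI) (auto intro: antisym)
    then have "columns_sum cs = columns_sum ds'"
      using Cons.prems(5) ds by (auto dest: tableau_add_left_cancel)
    then have "cs = ds'" using Cons.IH Cons.prems ds by auto
    then show ?case using \<open>c = d\<close> ds by simp
  }
qed

section \<open>Decomposition of a tableau into columns\<close>

text \<open>The rows that remain when the first column is removed. Rows that become empty are dropped, because
the rows of a tableau are nonempty.\<close>

definition tails :: "nat list list \<Rightarrow> nat list list" where
  "tails R = filter (\<lambda>r. r \<noteq> []) (map tl R)"

text \<open>As the row lengths are weakly decreasing, the rows dropped from the tails are the last ones, so the
remaining tails keep their row numbers.\<close>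

lemma star_rows_heads_tails:
  assumes "ssyt R"
  shows "star_rows (map (\<lambda>r. [hd r]) R) (tails R) = R"
  using assms
proof (induction R)
  case (Cons r R)
  have R: "ssyt R" and r: "r \<noteq> []" "sorted r" "\<forall>s\<in>set R. s \<noteq> [] \<and> length s \<le> length r"
    using Cons.prems by (auto simp: ssyt_def above_def)
  show ?case
  proof (cases "tl r = []")
    case True
    then have r1: "length r = 1" using r(1) by (cases r) auto
    then have R1: "length s = 1" if "s \<in> set R" for s
      using r(3) that by (cases s) fastforce+
    then have "tails (r # R) = []"
      using True by (fastforce simp: tails_def filter_empty_conv length_Suc_conv)
    moreover have "[hd s] = s" if "length s = 1" for s :: "nat list"
      using that by (cases s) auto
    then have "map (\<lambda>r. [hd r]) (r # R) = r # R"
      using r1 R1 by (intro map_idI) auto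
    ultimately show ?thesis by simp
  next
    case False
    have "sort ([hd r] @ tl r) = r" using r by (simp add: sorted_sort_id)
    then show ?thesis using False Cons.IH[OF R] by (simp add: tails_def)
  qed
qed (simp add: tails_def)

lemma ssyt_tails:
  assumes "ssyt R"
  shows "ssyt (tails R)"
proof -
  have R: "\<forall>r\<in>set R. r \<noteq> [] \<and> sorted r \<and> 0 \<notin> set r" "sorted_wrt above R"
    using assms by (auto simp: ssyt_def)
  have "above (tl r) (tl s)" if "above r s" for r s
    using that by (auto simp: above_def nth_tl)
  then have "sorted_wrt above (map tl R)"
    unfolding sorted_wrt_map by (rule sorted_wrt_mono_rel[OF _ R(2)])
  moreover have "sorted (tl r) \<and> 0 \<notin> set (tl r)" if "r \<in> set R" for r
    using R(1) that by (cases r) auto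
  ultimately show ?thesis
    by (auto simp: ssyt_def tails_def intro: sorted_wrt_filter)
qed

lemma column_heads:
  assumes "ssyt R" "R \<noteq> []"
  shows "column (map hd R)"
proof -
  have R: "\<forall>r\<in>set R. r \<noteq> [] \<and> 0 \<notin> set r" "sorted_wrt above R"
    using assms by (auto simp: ssyt_def)
  have "sorted_wrt (\<lambda>r s. hd r < hd s) R"
    using R(2)
  proof (rule sorted_wrt_mono_rel[rotated])
    fix r s assume "r \<in> set R" "s \<in> set R" "above r s"
    then show "hd r < hd s" using R(1) by (auto simp: above_def hd_conv_nth)
  qed
  then show ?thesis using R(1) assms(2)
    by (auto simp: column_def sorted_wrt_map) (metis hd_in_set)
qed

definition bounded_columns :: "nat \<Rightarrow> nat \<Rightarrow> nat list set" where
  "bounded_columns n m = {c. column c \<and> length c \<le> n \<and> set c \<subseteq> {1..m}}"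

lemma length_meet: "length (meet xs ys) = max (length xs) (length ys)"
  by (induction xs ys rule: meet.induct) auto

lemma length_join: "length (join xs ys) = min (length xs) (length ys)"
  by (induction xs ys rule: join.induct) auto

lemma bounded_columns_meet: "c \<in> bounded_columns n m \<Longrightarrow> d \<in> bounded_columns n m \<Longrightarrow> meet c d \<in> bounded_columns n m"
  using set_meet[of c d] by (auto simp: bounded_columns_def column_meet length_meet)

lemma bounded_columns_join: "c \<in> bounded_columns n m \<Longrightarrow> d \<in> bounded_columns n m \<Longrightarrow> join c d \<in> bounded_columns n m"
  using set_join[of c d] by (fastforce simp: bounded_columns_def column_join length_join max_def split: if_splits)

lemma finite_bounded_columns: "finite (bounded_columns n m)"
  by (rule finite_subset[OF _ finite_lists_length_le[of "{1..m}" n]]) (auto simp: bounded_columns_def)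

lemma one_column_eq: "one_column n m = column_tableau ` bounded_columns n m"
proof (intro set_eqI iffI)
  fix T assume T: "T \<in> one_column n m"
  define c where "c = map hd (rows T)"
  have rT: "rows T = map (\<lambda>x. [x]) c"
    unfolding c_def map_map using T
    by (intro map_idI[symmetric]) (auto simp: one_column_def length_Suc_conv)
  have c: "column c"
    unfolding c_def using rows[of T] T by (intro column_heads) (auto simp: one_column_def)
  have "T = column_tableau c"
    using rT rows_column_tableau[OF c] by (simp flip: rows_inject)
  moreover have "c \<in> bounded_columns n m"
    using T c by (auto simp: bounded_columns_def one_column_def SSYT_def rT)
  ultimately show "T \<in> column_tableau ` bounded_columns n m" by blast
next
  fix T assume "T \<in> column_tableau ` bounded_columns n m"
  then obtain c where "c \<in> bounded_columns n m" "T = column_tableau c" by blast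
  then show "T \<in> one_column n m"
    by (auto simp: one_column_def SSYT_def bounded_columns_def rows_column_tableau column_def)
qed

lemma SSYT_columns:
  assumes "T \<in> SSYT n m"
  shows "\<exists>cs. set cs \<subseteq> bounded_columns n m \<and> columns_sum cs = T"
  using assms
proof (induction "sum_list (map length (rows T))" arbitrary: T rule: less_induct)
  case less
  show ?case
  proof (cases "rows T = []")
    case True
    then have "T = 0" by (simp add: zero_tableau.rep_eq flip: rows_inject)
    then show ?thesis by (intro exI[of _ "[]"]) simp
  next
    case False
    have R: "ssyt (rows T)" using rows[of T] by simp
    define c where "c = map hd (rows T)"
    define U where "U = Tableau (tails (rows T))"
    have c: "column c" unfolding c_def by (rule column_heads[OF R False])
    have U: "rows U = tails (rows T)"
      unfolding U_def using ssyt_tails[OF R] by (simp add: Tableau_inverse)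
    have T: "column_tableau c + U = T"
      using star_rows_heads_tails[OF R] rows_column_tableau[OF c, unfolded c_def]
      by (simp add: plus_tableau.rep_eq U c_def comp_def flip: rows_inject)
    have ne: "\<forall>r\<in>set (rows T). r \<noteq> []" using R by (auto simp: ssyt_def)
    have sub: "length (rows T) \<le> n" "\<forall>r\<in>set (rows T). set r \<subseteq> {1..m}"
      using less(2) by (auto simp: SSYT_def)
    have cc: "c \<in> bounded_columns n m"
      using c sub ne hd_in_set by (fastforce simp: bounded_columns_def c_def)
    have "set (tl r) \<subseteq> set r" for r :: "nat list" by (cases r) auto
    then have US: "U \<in> SSYT n m"
      using sub length_filter_le[of _ "map tl (rows T)"]
      by (fastforce simp: SSYT_def U tails_def intro: order.trans[OF length_filter_le])
    have "sum_list (map length (tails R)) \<le> sum_list (map length (map tl R))" for R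
      by (induction R) (auto simp: tails_def)
    also have "sum_list (map length (map tl (rows T))) < sum_list (map length (rows T))"
      unfolding map_map using False ne by (intro sum_list_strict_mono) (auto simp: comp_def)
    finally have "sum_list (map length (rows U)) < sum_list (map length (rows T))"
      unfolding U .
    from less(1)[OF this US] obtain cs where "set cs \<subseteq> bounded_columns n m" "columns_sum cs = U" by blast
    then show ?thesis using cc T by (intro exI[of _ "c # cs"]) auto
  qed
qed

section \<open>Multiplicative functions from scalar families\<close>

definition weight :: "(tableau \<Rightarrow> 'k::comm_monoid_mult) \<Rightarrow> nat list list \<Rightarrow> 'k" where
  "weight \<mu> cs = prod_list (map (\<lambda>c. \<mu> (column_tableau c)) cs)"

lemma weight_simps [simp]:
  "weight \<mu> [] = 1" "weight \<mu> (c # cs) = \<mu> (column_tableau c) * weight \<mu> cs"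
  "weight \<mu> (cs @ ds) = weight \<mu> cs * weight \<mu> ds"
  by (simp_all add: weight_def)

text \<open>In each row, two entries that together form the multiset of two equal entries coincide with them.\<close>

lemma column_tableau_plus_eq_double:
  assumes "column c" "column d" "column e"
    and "column_tableau c + column_tableau d = column_tableau e + column_tableau e"
  shows "c = e \<and> d = e"
proof -
  have eq: "row_content (column_tableau c) i + row_content (column_tableau d) i =
    row_content (column_tableau e) i + row_content (column_tableau e) i" for i
    using arg_cong[OF assms(4), of "\<lambda>T. row_content T i"] by (simp add: row_content_plus)
  have *: "(i < length c \<longleftrightarrow> i < length e) \<and> (i < length d \<longleftrightarrow> i < length e) \<and>
    (i < length e \<longrightarrow> c ! i = e ! i \<and> d ! i = e ! i)" for i
    using eq[of i] assms(1-3)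
    by (auto simp: row_content_column_tableau add_eq_conv_ex split: if_splits)
  then have "length c = length e" "length d = length e"
    by (meson linorder_neqE_nat nat_neq_iff)+
  then show ?thesis using * by (auto intro: nth_equalityI)
qed

text \<open>The defining relations concern four distinct tableaux, but the others hold as well: if two factors
on the same side agree, then all four agree, and a factor common to both sides can be cancelled.\<close>

lemma scalar_families_mult:
  assumes \<mu>: "\<mu> \<in> scalar_families n m" and T: "T1 \<in> one_column n m" "T2 \<in> one_column n m"
    "T3 \<in> one_column n m" "T4 \<in> one_column n m" and eq: "T1 + T2 = T3 + T4"
  shows "\<mu> T1 * \<mu> T2 = \<mu> T3 * \<mu> T4"
proof (cases "distinct [T1, T2, T3, T4]")
  case True
  then show ?thesis using assms unfolding scalar_families_def by blast
next
  case False
  have double: "S1 = U \<and> S2 = U" if "S1 + S2 = U + U"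
    "S1 \<in> one_column n m" "S2 \<in> one_column n m" "U \<in> one_column n m" for S1 S2 U
    using that column_tableau_plus_eq_double unfolding one_column_eq bounded_columns_def by blast
  consider "T1 = T2" | "T3 = T4" | "T1 = T3" | "T1 = T4" | "T2 = T3" | "T2 = T4"
    using False by auto
  then show ?thesis
  proof cases
    case 1
    then show ?thesis using double[of T3 T4 T1] T eq by simp
  next
    case 2
    then show ?thesis using double[of T1 T2 T3] T eq by simp
  next
    case 3
    then show ?thesis using tableau_add_left_cancel[of T1 T2 T4] eq by simp
  next
    case 4
    then show ?thesis using tableau_add_left_cancel[of T1 T2 T3] eq by (simp add: add.commute mult.commute)
  next
    case 5
    then show ?thesis using tableau_add_left_cancel[of T2 T1 T4] eq by (simp add: add.commute mult.commute)
  next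
    case 6
    then show ?thesis using tableau_add_left_cancel[of T2 T1 T3] eq by (simp add: add.commute mult.commute)
  qed
qed

lemma weight_insert_column:
  assumes \<mu>: "\<mu> \<in> scalar_families n m"
  shows "c \<in> bounded_columns n m \<Longrightarrow> set ds \<subseteq> bounded_columns n m \<Longrightarrow>
    weight \<mu> (insert_column c ds) = \<mu> (column_tableau c) * weight \<mu> ds"
proof (induction c ds rule: insert_column.induct)
  case (2 c d ds)
  have "\<mu> (column_tableau (meet c d)) * \<mu> (column_tableau (join c d)) =
    \<mu> (column_tableau c) * \<mu> (column_tableau d)"
  proof (rule scalar_families_mult[OF \<mu>])
    show "column_tableau (meet c d) + column_tableau (join c d) = column_tableau c + column_tableau d"
      using 2(2,3) by (intro meet_plus_join) (auto simp: bounded_columns_def)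
  qed (use 2(2,3) in \<open>auto simp: one_column_eq bounded_columns_meet bounded_columns_join\<close>)
  then show ?case using 2 by (simp add: bounded_columns_join mult.assoc[symmetric])
qed auto

lemma chain_normal_form:
  assumes \<mu>: "\<mu> \<in> scalar_families n m" and "set cs \<subseteq> bounded_columns n m"
  shows "\<exists>ds. set ds \<subseteq> bounded_columns n m \<and> sorted_wrt col_le ds \<and> columns_sum ds = columns_sum cs \<and>
    weight \<mu> ds = weight \<mu> cs"
  using assms(2)
proof (induction cs)
  case (Cons c cs)
  then obtain ds where ds: "set ds \<subseteq> bounded_columns n m" "sorted_wrt col_le ds"
    "columns_sum ds = columns_sum cs" "weight \<mu> ds = weight \<mu> cs" by auto
  have c: "c \<in> bounded_columns n m" using Cons.prems by simp
  have "set (insert_column c ds) \<subseteq> bounded_columns n m"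
    using c ds(1) by (induction c ds rule: insert_column.induct) (auto simp: bounded_columns_meet bounded_columns_join)
  then show ?case
    using ds c sorted_insert_column[OF ds(2), of c] weight_insert_column[OF \<mu> c ds(1)]
      columns_sum_insert_column[of c ds]
    by (intro exI[of _ "insert_column c ds"]) (auto simp: bounded_columns_def)
qed (auto intro: exI[of _ "[]"])

text \<open>Both lists straighten to chains with the same sum, which are equal.\<close>

lemma weight_cong:
  assumes \<mu>: "\<mu> \<in> scalar_families n m" and "set cs \<subseteq> bounded_columns n m" "set ds \<subseteq> bounded_columns n m"
    and "columns_sum cs = columns_sum ds"
  shows "weight \<mu> cs = weight \<mu> ds"
proof -
  obtain cs' where cs': "set cs' \<subseteq> bounded_columns n m" "sorted_wrt col_le cs'" "columns_sum cs' = columns_sum cs"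
    "weight \<mu> cs' = weight \<mu> cs" using chain_normal_form[OF \<mu> assms(2)] by blast
  obtain ds' where ds': "set ds' \<subseteq> bounded_columns n m" "sorted_wrt col_le ds'" "columns_sum ds' = columns_sum ds"
    "weight \<mu> ds' = weight \<mu> ds" using chain_normal_form[OF \<mu> assms(3)] by blast
  have "cs' = ds'"
    using cs' ds' assms(4) by (intro chain_unique) (auto simp: bounded_columns_def)
  then show ?thesis using cs' ds' by simp
qed

text \<open>Any decomposition into columns may be chosen, by \<open>weight_cong\<close>.\<close>

definition character :: "nat \<Rightarrow> nat \<Rightarrow> (tableau \<Rightarrow> 'k::field) \<Rightarrow> tableau \<Rightarrow> 'k" where
  "character n m \<mu> T = weight \<mu> (SOME cs. set cs \<subseteq> bounded_columns n m \<and> columns_sum cs = T)"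

lemma character_columns_sum:
  assumes "\<mu> \<in> scalar_families n m" "set cs \<subseteq> bounded_columns n m"
  shows "character n m \<mu> (columns_sum cs) = weight \<mu> cs"
proof -
  define ds where "ds = (SOME ds. set ds \<subseteq> bounded_columns n m \<and> columns_sum ds = columns_sum cs)"
  have "set ds \<subseteq> bounded_columns n m \<and> columns_sum ds = columns_sum cs"
    unfolding ds_def by (rule someI[of _ cs]) (use assms in auto)
  then have "weight \<mu> ds = weight \<mu> cs" using assms by (intro weight_cong[OF assms(1)]) auto
  then show ?thesis by (simp add: character_def ds_def)
qed

lemma character:
  assumes \<mu>: "\<mu> \<in> scalar_families n m"
  shows "character n m \<mu> 0 = 1"
    and "S \<in> SSYT n m \<Longrightarrow> T \<in> SSYT n m \<Longrightarrow> character n m \<mu> (S + T) = character n m \<mu> S * character n m \<mu> T"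
    and "T \<in> one_column n m \<Longrightarrow> character n m \<mu> T = \<mu> T"
proof -
  show "character n m \<mu> 0 = 1"
    using character_columns_sum[OF \<mu>, of "[]"] by simp
  show "character n m \<mu> T = \<mu> T" if T: "T \<in> one_column n m"
  proof -
    obtain c where "c \<in> bounded_columns n m" "T = column_tableau c"
      using T unfolding one_column_eq by blast
    then show ?thesis using character_columns_sum[OF \<mu>, of "[c]"] by simp
  qed
  show "character n m \<mu> (S + T) = character n m \<mu> S * character n m \<mu> T"
    if ST: "S \<in> SSYT n m" "T \<in> SSYT n m"
  proof -
    obtain cs ds where "set cs \<subseteq> bounded_columns n m" "columns_sum cs = S" "set ds \<subseteq> bounded_columns n m" "columns_sum ds = T"
      using SSYT_columns[OF ST(1)] SSYT_columns[OF ST(2)] by blast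
    then show ?thesis
      using character_columns_sum[OF \<mu>, of "cs @ ds"] character_columns_sum[OF \<mu>, of cs]
        character_columns_sum[OF \<mu>, of ds] by simp
  qed
qed

section \<open>Linear extension to the tableaux algebra\<close>
lemma single_eq_map: "Poly_Mapping.single T c = Poly_Mapping.map (times c) (Poly_Mapping.single T (1::'k::field))"
  by (rule poly_mapping_eqI) (simp add: map.rep_eq lookup_single when_def)

lemma lookup_map_times: "Poly_Mapping.lookup (Poly_Mapping.map (times c) a) T = c * (Poly_Mapping.lookup a T :: 'k::field)"
  by (simp add: map.rep_eq when_def)

lemma sum_single_lookup: "(\<Sum>T\<in>Poly_Mapping.keys a. Poly_Mapping.single T (Poly_Mapping.lookup a T)) = (a :: 'a \<Rightarrow>\<^sub>0 'k::comm_monoid_add)"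
  by (rule poly_mapping_eqI)
    (simp add: lookup_sum lookup_single when_def in_keys_iff)

lemma subring_tableaux_algebra: "subring (tableaux_algebra n m :: (tableau \<Rightarrow>\<^sub>0 'k::field) set)"
  unfolding subring_def
proof (intro conjI ballI)
  fix a b :: "tableau \<Rightarrow>\<^sub>0 'k" assume "a \<in> tableaux_algebra n m" "b \<in> tableaux_algebra n m"
  then show "a - b \<in> tableaux_algebra n m" "a * b \<in> tableaux_algebra n m"
    using keys_diff[of a b] tableaux_algebra_closed(3)[of a n m b]
    by (auto simp: tableaux_algebra_def)
qed (rule tableaux_algebra_closed)

lemma one_column_in_algebra:
  "T \<in> one_column n m \<Longrightarrow> Poly_Mapping.single T 1 \<in> tableaux_algebra n m"
  by (simp add: tableaux_algebra_def one_column_def)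

text \<open>The one-column tableaux generate the tableaux algebra.\<close>

lemma tableaux_algebra_induct [consumes 1, case_names one column add mult scale]:
  fixes a :: "tableau \<Rightarrow>\<^sub>0 'k::field"
  assumes a: "a \<in> tableaux_algebra n m"
    and one: "P 1"
    and col: "\<And>T. T \<in> one_column n m \<Longrightarrow> P (Poly_Mapping.single T 1)"
    and add: "\<And>a b. a \<in> tableaux_algebra n m \<Longrightarrow> b \<in> tableaux_algebra n m \<Longrightarrow> P a \<Longrightarrow> P b \<Longrightarrow> P (a + b)"
    and mult: "\<And>a b. a \<in> tableaux_algebra n m \<Longrightarrow> b \<in> tableaux_algebra n m \<Longrightarrow> P a \<Longrightarrow> P b \<Longrightarrow> P (a * b)"
    and scale: "\<And>c a. a \<in> tableaux_algebra n m \<Longrightarrow> P a \<Longrightarrow> P (Poly_Mapping.map (times c) a)"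
  shows "P a"
proof -
  let ?A = "tableaux_algebra n m :: (tableau \<Rightarrow>\<^sub>0 'k) set"
  note A = tableaux_algebra_closed[where n = n and m = m]
  have col_in: "column_tableau c \<in> one_column n m \<and> column_tableau c \<in> SSYT n m" if "c \<in> bounded_columns n m" for c
    using that unfolding one_column_eq[symmetric] by (metis (lifting) imageI mem_Collect_eq one_column_def one_column_eq)
  have "P (Poly_Mapping.single (columns_sum cs) 1) \<and> columns_sum cs \<in> SSYT n m"
    if "set cs \<subseteq> bounded_columns n m" for cs
    using that
  proof (induction cs)
    case Nil
    then show ?case using one by (simp add: SSYT_zero)
  next
    case (Cons c cs)
    have eq: "Poly_Mapping.single (columns_sum (c # cs)) (1::'k) =
      Poly_Mapping.single (column_tableau c) 1 * Poly_Mapping.single (columns_sum cs) 1"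
      by (simp add: mult_single)
    show ?case
      unfolding eq using Cons col_in[of c] by (auto intro!: mult col A(5) SSYT_plus)
  qed
  then have basis: "P (Poly_Mapping.single T 1)" if "T \<in> SSYT n m" for T
    using SSYT_columns[OF that] by blast
  have "P (\<Sum>T\<in>X. Poly_Mapping.single T (Poly_Mapping.lookup a T)) \<and> (\<Sum>T\<in>X. Poly_Mapping.single T (Poly_Mapping.lookup a T)) \<in> ?A"
    if "finite X" "X \<subseteq> SSYT n m" for X
    using that
  proof (induction X rule: finite_induct)
    case empty
    have "Poly_Mapping.map (times 0) (1 :: tableau \<Rightarrow>\<^sub>0 'k) = 0"
      by (rule poly_mapping_eqI) (simp add: lookup_map_times)
    then show ?case using scale[OF A(1) one, of 0] by (simp add: tableaux_algebra_def)
  next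
    case (insert T X)
    have "P (Poly_Mapping.single T (Poly_Mapping.lookup a T)) \<and> Poly_Mapping.single T (Poly_Mapping.lookup a T) \<in> ?A"
      unfolding single_eq_map[of T "Poly_Mapping.lookup a T"] using insert.prems
      by (intro conjI scale basis A) auto
    then show ?case using insert by (auto intro: add A)
  qed
  from this[of "Poly_Mapping.keys a"] a show ?thesis
    by (simp add: sum_single_lookup tableaux_algebra_def)
qed

definition linear_character :: "nat \<Rightarrow> nat \<Rightarrow> (tableau \<Rightarrow> 'k::field) \<Rightarrow> (tableau \<Rightarrow>\<^sub>0 'k) \<Rightarrow> 'k" where
  "linear_character n m \<mu> a = (\<Sum>T\<in>Poly_Mapping.keys a. Poly_Mapping.lookup a T * character n m \<mu> T)"

lemma linear_character_superset:
  assumes "finite X" "Poly_Mapping.keys a \<subseteq> X"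
  shows "linear_character n m \<mu> a = (\<Sum>T\<in>X. Poly_Mapping.lookup a T * character n m \<mu> T)"
  unfolding linear_character_def
  by (rule sum.mono_neutral_left) (use assms in \<open>auto simp: in_keys_iff\<close>)

lemma linear_character_add:
  "linear_character n m \<mu> (a + b) = linear_character n m \<mu> a + linear_character n m \<mu> b"
  using keys_add[of a b]
  by (simp add: linear_character_superset[of "Poly_Mapping.keys a \<union> Poly_Mapping.keys b"] lookup_add distrib_right sum.distrib)

lemma linear_character_0: "linear_character n m \<mu> 0 = 0"
  by (simp add: linear_character_def)

lemma linear_character_sum:
  "linear_character n m \<mu> (sum f X) = (\<Sum>i\<in>X. linear_character n m \<mu> (f i))"
  by (induction X rule: infinite_finite_induct) (auto simp: linear_character_add linear_character_0)

lemma linear_character_single: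
  "linear_character n m \<mu> (Poly_Mapping.single T c) = c * character n m \<mu> T"
  by (simp add: linear_character_def)

lemma linear_character_scale:
  "linear_character n m \<mu> (Poly_Mapping.map (times c) a) = c * linear_character n m \<mu> a"
proof -
  have "Poly_Mapping.keys (Poly_Mapping.map (times c) a) \<subseteq> Poly_Mapping.keys a"
    by (auto simp: in_keys_iff lookup_map_times)
  then show ?thesis
    by (simp add: linear_character_superset[of "Poly_Mapping.keys a"] lookup_map_times sum_distrib_left mult.assoc)
qed

lemma linear_character_mult:
  assumes \<mu>: "\<mu> \<in> scalar_families n m" and a: "a \<in> tableaux_algebra n m" and b: "b \<in> tableaux_algebra n m"
  shows "linear_character n m \<mu> (a * b) = linear_character n m \<mu> a * linear_character n m \<mu> b"
proof -
  have "a * b = (\<Sum>S\<in>Poly_Mapping.keys a. \<Sum>T\<in>Poly_Mapping.keys b. Poly_Mapping.single (S + T) (Poly_Mapping.lookup a S * Poly_Mapping.lookup b T))"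
    by (subst (1 2) sum_single_lookup[symmetric]) (simp add: sum_product mult_single)
  then have "linear_character n m \<mu> (a * b) =
    (\<Sum>S\<in>Poly_Mapping.keys a. \<Sum>T\<in>Poly_Mapping.keys b. Poly_Mapping.lookup a S * Poly_Mapping.lookup b T * character n m \<mu> (S + T))"
    by (simp add: linear_character_sum linear_character_single)
  also have "\<dots> = (\<Sum>S\<in>Poly_Mapping.keys a. \<Sum>T\<in>Poly_Mapping.keys b. (Poly_Mapping.lookup a S * character n m \<mu> S) * (Poly_Mapping.lookup b T * character n m \<mu> T))"
    using a b by (intro sum.cong refl) (simp add: tableaux_algebra_def subset_iff character(2)[OF \<mu>])
  finally show ?thesis by (simp add: linear_character_def sum_product)
qed

text \<open>The space is arbitrary: on the field itself this realises a given family of scalars, and on a line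
it is the representation to compare others with.\<close>

definition scalar_representation ::
  "nat \<Rightarrow> nat \<Rightarrow> ('k::field \<Rightarrow> 'v::ab_group_add \<Rightarrow> 'v) \<Rightarrow> (tableau \<Rightarrow> 'k) \<Rightarrow> (tableau \<Rightarrow>\<^sub>0 'k) \<Rightarrow> 'v \<Rightarrow> 'v"
  where "scalar_representation n m scale \<mu> =
    restrict (\<lambda>a v. scale (linear_character n m \<mu> a) v) (tableaux_algebra n m)"

lemma linear_scale:
  assumes "vector_space scale"
  shows "Vector_Spaces.linear scale scale (scale c)"
proof -
  interpret vector_space scale by (rule assms)
  show ?thesis using assms by (simp add: Vector_Spaces.linear_iff scale_right_distrib mult.commute)
qed

lemma representation_scalar_representation:
  assumes vs: "vector_space scale" and \<mu>: "\<mu> \<in> scalar_families n m"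
  shows "representation n m scale (scalar_representation n m scale \<mu>)"
proof -
  interpret vector_space scale by (rule vs)
  note A = tableaux_algebra_closed[where n = n and m = m]
  have one: "linear_character n m \<mu> 1 = 1"
    using linear_character_single[of n m \<mu> 0 1] character(1)[OF \<mu>] by simp
  show ?thesis
    unfolding Defs.representation_def
  proof (intro conjI ballI allI)
    show "scalar_representation n m scale \<mu> 1 = id"
      by (auto simp: scalar_representation_def A one)
  qed (auto simp: scalar_representation_def A vs linear_scale linear_character_add
      linear_character_mult[OF \<mu>] linear_character_scale scale_left_distrib)
qed

lemma acts_by_scalars_scalar_representation:
  assumes \<mu>: "\<mu> \<in> scalar_families n m"
  shows "acts_by_scalars n m scale (scalar_representation n m scale \<mu>) \<mu>"
  by (auto simp: acts_by_scalars_def scalar_representation_def one_column_def tableaux_algebra_def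
      linear_character_single character(3)[OF \<mu>, unfolded one_column_def])

lemma representationD:
  assumes "representation n m scale \<rho>"
  shows "vector_space scale" "\<And>a. a \<in> tableaux_algebra n m \<Longrightarrow> Vector_Spaces.linear scale scale (\<rho> a)"
    "\<rho> \<in> extensional (tableaux_algebra n m)" "\<rho> 1 = id"
    "\<And>a b. a \<in> tableaux_algebra n m \<Longrightarrow> b \<in> tableaux_algebra n m \<Longrightarrow> \<rho> (a + b) = (\<lambda>v. \<rho> a v + \<rho> b v)"
    "\<And>a b. a \<in> tableaux_algebra n m \<Longrightarrow> b \<in> tableaux_algebra n m \<Longrightarrow> \<rho> (a * b) = \<rho> a \<circ> \<rho> b"
    "\<And>c a. a \<in> tableaux_algebra n m \<Longrightarrow> \<rho> (Poly_Mapping.map (times c) a) = (\<lambda>v. scale c (\<rho> a v))"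
  using assms unfolding Defs.representation_def by (auto simp: PiE_def Pi_def)

text \<open>Two homomorphisms that agree on generators agree.\<close>

lemma representation_eq_scalar_representation:
  assumes rep: "representation n m scale \<rho>" and \<mu>: "\<mu> \<in> scalar_families n m"
    and acts: "acts_by_scalars n m scale \<rho> \<mu>"
  shows "\<rho> = scalar_representation n m scale \<mu>"
proof (rule extensionalityI)
  note \<rho> = representationD[OF rep]
  note \<sigma> = representationD[OF representation_scalar_representation[OF \<rho>(1) \<mu>]]
  show "\<rho> \<in> extensional (tableaux_algebra n m)" by (rule \<rho>)
  show "scalar_representation n m scale \<mu> \<in> extensional (tableaux_algebra n m)" by (rule \<sigma>)
  fix a :: "tableau \<Rightarrow>\<^sub>0 'a" assume "a \<in> tableaux_algebra n m"
  then show "\<rho> a = scalar_representation n m scale \<mu> a"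
  proof (induction a rule: tableaux_algebra_induct)
    case (column T)
    then show ?case
      using acts acts_by_scalars_scalar_representation[OF \<mu>, of scale] by (auto simp: acts_by_scalars_def)
  qed (simp_all add: \<rho> \<sigma>)
qed

section \<open>One-dimensional representations\<close>

lemma dim_eq_1_iff:
  assumes "vector_space scale"
  shows "vector_space.dim scale UNIV = 1 \<longleftrightarrow> (\<exists>v. v \<noteq> 0 \<and> (\<forall>w. \<exists>c. w = scale c v))"
proof -
  interpret vector_space scale by (rule assms)
  show ?thesis
  proof
    assume "dim UNIV = 1"
    then obtain B where B: "independent B" "UNIV \<subseteq> span B" "card B = 1"
      using basis_exists[of UNIV] by metis
    then obtain v where "B = {v}" by (auto simp: card_1_singleton_iff)
    with B show "\<exists>v. v \<noteq> 0 \<and> (\<forall>w. \<exists>c. w = scale c v)"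
      by (intro exI[of _ v]) (auto simp: span_singleton)
  next
    assume "\<exists>v. v \<noteq> 0 \<and> (\<forall>w. \<exists>c. w = scale c v)"
    then obtain v where "v \<noteq> 0" "\<forall>w. \<exists>c. w = scale c v" by blast
    then show "dim UNIV = 1"
      by (intro dim_unique[of "{v}"]) (auto simp: span_singleton)
  qed
qed

lemma line_generated_by_any:
  assumes "vector_space scale" and dim: "vector_space.dim scale UNIV = 1" and "v \<noteq> 0"
  shows "\<exists>c. w = scale c v"
proof -
  interpret vector_space scale by (rule assms)
  obtain u where u: "\<And>w. \<exists>c. w = scale c u"
    using dim unfolding dim_eq_1_iff[OF assms(1)] by blast
  obtain c where c: "v = scale c u" using u by blast
  with \<open>v \<noteq> 0\<close> have "c \<noteq> 0" by auto
  then have "u = scale (inverse c) v" by (simp add: c)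
  with u[of w] show ?thesis by (metis scale_scale)
qed

text \<open>A nonzero vector of a line generates it, so the line has no proper nonzero subspaces at all.\<close>

lemma dim_1_imp_irreducible:
  assumes rep: "representation n m scale \<rho>" and dim: "vector_space.dim scale UNIV = 1"
  shows "irreducible_representation n m scale \<rho>"
proof -
  have vs: "vector_space scale" by (rule representationD[OF rep])
  interpret vector_space scale by (rule vs)
  obtain v :: 'b where "v \<noteq> 0" using dim unfolding dim_eq_1_iff[OF vs] by blast
  then have nonzero: "(UNIV :: 'b set) \<noteq> {0}" by auto
  have "W = {0} \<or> W = UNIV" if W: "subspace W" for W
  proof (rule disjCI)
    assume "W \<noteq> UNIV"
    have "w = 0" if "w \<in> W" for w
    proof (rule ccontr)
      assume "w \<noteq> 0"
      then have "u \<in> W" for u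
        using line_generated_by_any[OF vs dim, of w u] subspace_scale[OF W that] by blast
      with \<open>W \<noteq> UNIV\<close> show False by blast
    qed
    then show "W = {0}" using subspace_0[OF W] by blast
  qed
  with rep nonzero show ?thesis unfolding irreducible_representation_def by blast
qed

section \<open>Irreducible representations\<close>

lemma subring_constants:
  "subring (range (Poly_Mapping.single 0) :: (tableau \<Rightarrow>\<^sub>0 'k::field) set)"
  unfolding subring_def by (auto simp: mult_single simp flip: single_diff single_one)

lemma tableaux_algebra_finitely_generated:
  obtains xs where
    "adjoin_list (range (Poly_Mapping.single 0)) xs = (tableaux_algebra n m :: (tableau \<Rightarrow>\<^sub>0 'k::field) set)"
proof -
  let ?R = "range (Poly_Mapping.single 0) :: (tableau \<Rightarrow>\<^sub>0 'k) set"
  let ?A = "tableaux_algebra n m :: (tableau \<Rightarrow>\<^sub>0 'k) set"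
  note R = subring_constants[where ?'k = 'k]
  have "finite ((\<lambda>T. Poly_Mapping.single T (1::'k)) ` one_column n m)"
    unfolding one_column_eq by (intro finite_imageI finite_bounded_columns)
  from finite_list[OF this]
  obtain xs where xs: "set xs = (\<lambda>T. Poly_Mapping.single T (1::'k)) ` one_column n m" ..
  note S = adjoin_list[OF R, of xs]
  have "adjoin_list ?R xs \<subseteq> ?A"
    by (rule adjoin_list_least[OF subring_tableaux_algebra])
      (auto simp: xs tableaux_algebra_def SSYT_zero one_column_def split: if_splits)
  moreover have "a \<in> adjoin_list ?R xs" if "a \<in> ?A" for a
    using that
  proof (induction a rule: tableaux_algebra_induct)
    case (scale c a)
    have "Poly_Mapping.map (times c) a = Poly_Mapping.single 0 c * a"
    proof -
      have "Poly_Mapping.single 0 c * a = (\<Sum>T\<in>Poly_Mapping.keys a. Poly_Mapping.single T (c * Poly_Mapping.lookup a T))"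
        by (subst (1) sum_single_lookup[of a, symmetric]) (simp add: sum_distrib_left mult_single)
      also have "\<dots> = Poly_Mapping.map (times c) a"
        by (rule poly_mapping_eqI)
          (simp add: lookup_sum lookup_single when_def in_keys_iff lookup_map_times)
      finally show ?thesis by simp
    qed
    then show ?case using S(2) scale by (auto intro: subringD[OF S(1)])
  qed (use S xs in \<open>auto intro: subringD[OF S(1)]\<close>)
  ultimately show ?thesis using that[of xs] by blast
qed

locale irreducible_module =
  fixes n m :: nat and scale :: "'k::alg_closed_field \<Rightarrow> 'v::ab_group_add \<Rightarrow> 'v"
    and \<rho> :: "(tableau \<Rightarrow>\<^sub>0 'k) \<Rightarrow> 'v \<Rightarrow> 'v"
  assumes irreducible: "irreducible_representation n m scale \<rho>"
begin

abbreviation A :: "(tableau \<Rightarrow>\<^sub>0 'k) set" where "A \<equiv> tableaux_algebra n m"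

lemma rep: "representation n m scale \<rho>"
  using irreducible by (simp add: irreducible_representation_def)

lemmas \<rho> = representationD[OF rep]
lemmas A_closed = subringD[OF subring_tableaux_algebra[where ?'k = 'k and n = n and m = m]]
  tableaux_algebra_closed(4)[where n = n and m = m]

sublocale vector_space scale by (rule \<rho>(1))

lemma \<rho>_linear:
  assumes "a \<in> A"
  shows "\<rho> a (v + w) = \<rho> a v + \<rho> a w" "\<rho> a (scale c v) = scale c (\<rho> a v)" "\<rho> a 0 = 0"
proof -
  show "\<rho> a (v + w) = \<rho> a v + \<rho> a w"
    using \<rho>(2)[OF assms] by (simp add: Vector_Spaces.linear_iff)
  show sc: "\<rho> a (scale c v) = scale c (\<rho> a v)" for c v
    using \<rho>(2)[OF assms] by (simp add: Vector_Spaces.linear_iff)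
  show "\<rho> a 0 = 0" using sc[of 0 0] by simp
qed

lemma \<rho>_commute: "a \<in> A \<Longrightarrow> b \<in> A \<Longrightarrow> \<rho> a (\<rho> b v) = \<rho> b (\<rho> a v)"
  using fun_cong[OF \<rho>(6), of a b v] fun_cong[OF \<rho>(6), of b a v] by (simp add: mult.commute)

lemma simple:
  assumes "subspace W" "\<And>a w. a \<in> A \<Longrightarrow> w \<in> W \<Longrightarrow> \<rho> a w \<in> W" "w \<in> W" "w \<noteq> 0"
  shows "v \<in> W"
proof -
  have "W = {0} \<or> W = UNIV"
    using irreducible assms(1,2) unfolding irreducible_representation_def by blast
  with assms(3,4) show ?thesis by auto
qed

lemma nonzero_vector: obtains v :: 'v where "v \<noteq> 0"
proof -
  have "(UNIV :: 'v set) \<noteq> {0}"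
    using irreducible unfolding irreducible_representation_def by blast
  then show ?thesis using that by auto
qed

text \<open>As the algebra is commutative, the kernel of \<open>\<rho> a\<close> is invariant.\<close>

lemma kernel_trivial:
  assumes a: "a \<in> A" and "\<rho> a w = 0" "w \<noteq> 0"
  shows "\<rho> a v = 0"
proof -
  have "v \<in> {v. \<rho> a v = 0}"
  proof (rule simple[where w = w])
    show "subspace {v. \<rho> a v = 0}"
      by (rule subspaceI) (simp_all add: \<rho>_linear[OF a])
    show "\<rho> b v \<in> {v. \<rho> a v = 0}" if "b \<in> A" "v \<in> {v. \<rho> a v = 0}" for b v
      using that \<rho>_commute[OF a that(1), of v] by (simp add: \<rho>_linear)
  qed (use assms in auto)
  then show ?thesis by simp
qed

lemma transitive:
  assumes "w \<noteq> 0"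
  shows "\<exists>b\<in>A. \<rho> b w = v"
proof -
  let ?W = "(\<lambda>b. \<rho> b w) ` A"
  have mem: "x \<in> ?W" if "b \<in> A" "x = \<rho> b w" for b x
    using that by blast
  have "v \<in> ?W"
  proof (rule simple[where w = w])
    show "subspace ?W"
    proof (rule subspaceI)
      show "0 \<in> ?W"
        by (rule mem[of "Poly_Mapping.map (times 0) 1"]) (simp_all add: \<rho>(7) A_closed)
      show "x + y \<in> ?W" if xy: "x \<in> ?W" "y \<in> ?W" for x y
      proof -
        from xy obtain a b where "a \<in> A" "b \<in> A" "x = \<rho> a w" "y = \<rho> b w" by blast
        then show ?thesis by (intro mem[of "a + b"]) (simp_all add: \<rho>(5) A_closed)
      qed
      show "scale c x \<in> ?W" if x: "x \<in> ?W" for c x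
      proof -
        from x obtain a where "a \<in> A" "x = \<rho> a w" by blast
        then show ?thesis by (intro mem[of "Poly_Mapping.map (times c) a"]) (simp_all add: \<rho>(7) A_closed)
      qed
    qed
    show "\<rho> a x \<in> ?W" if a: "a \<in> A" and x: "x \<in> ?W" for a x
    proof -
      from x obtain b where "b \<in> A" "x = \<rho> b w" by blast
      with a show ?thesis by (intro mem[of "a * b"]) (simp_all add: \<rho>(6) A_closed)
    qed
    show "w \<in> ?W" by (rule mem[of 1]) (simp_all add: \<rho>(4) A_closed)
  qed (rule assms)
  then show ?thesis by blast
qed

definition annihilator :: "(tableau \<Rightarrow>\<^sub>0 'k) set" where
  "annihilator = {a \<in> A. \<rho> a = (\<lambda>v. 0)}"

lemma annihilator_iff: "w \<noteq> 0 \<Longrightarrow> a \<in> A \<Longrightarrow> a \<in> annihilator \<longleftrightarrow> \<rho> a w = 0"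
  using kernel_trivial by (auto simp: annihilator_def)

lemma \<rho>_const: "\<rho> (Poly_Mapping.single 0 c) v = scale c v"
  using \<rho>(7)[OF A_closed(1), of c] single_eq_map[of "0::tableau" c] by (simp add: \<rho>(4))

lemma const_mem: "Poly_Mapping.single 0 c \<in> A"
  by (simp add: tableaux_algebra_def SSYT_zero)

lemma \<rho>_diff: "a \<in> A \<Longrightarrow> b \<in> A \<Longrightarrow> \<rho> (a - b) v = \<rho> a v - \<rho> b v"
  using fun_cong[OF \<rho>(5), of "a - b" b v] A_closed(3)[of a b] by simp

text \<open>By \<open>annihilator_iff\<close>, membership can be tested on any nonzero vector. If \<open>b\<close> is not in the
annihilator, test \<open>a * b\<close> on \<open>v\<close> and \<open>a\<close> on the nonzero vector \<open>\<rho> b v\<close>.\<close>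

lemma prime_annihilator: "prime_ideal_in A annihilator"
proof -
  obtain v :: 'v where v: "v \<noteq> 0" by (rule nonzero_vector)
  note iff = annihilator_iff[OF v]
  have mult: "a * b \<in> annihilator \<longleftrightarrow> a \<in> annihilator \<or> b \<in> annihilator" if "a \<in> A" "b \<in> A" for a b
  proof (cases "b \<in> annihilator")
    case True
    then show ?thesis using that
      by (simp add: iff A_closed \<rho>(6) \<rho>_linear)
  next
    case False
    then have bv: "\<rho> b v \<noteq> 0" using iff[OF that(2)] by simp
    have ab: "a * b \<in> A" using that by (rule A_closed)
    have "\<rho> (a * b) v = \<rho> a (\<rho> b v)" using that by (simp add: \<rho>(6))
    then show ?thesis
      using iff[OF ab] annihilator_iff[OF bv that(1)] False by presburger
  qed
  show ?thesis
    unfolding prime_ideal_in_def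
  proof (intro conjI ballI impI)
    show "0 \<in> annihilator" using \<rho>_const[of 0 v] iff[OF A_closed(2)] by simp
    show "1 \<notin> annihilator" using v iff[OF A_closed(1)] by (simp add: \<rho>(4))
    fix a b assume "a \<in> A" "b \<in> A"
    then show "a * b \<in> annihilator \<longleftrightarrow> a \<in> annihilator \<or> b \<in> annihilator" by (rule mult)
  next
    fix a b assume "a \<in> A" "b \<in> A" "a \<in> annihilator \<and> b \<in> annihilator"
    then show "a + b \<in> annihilator" by (simp add: annihilator_def \<rho>(5) A_closed)
  qed
qed

text \<open>The homomorphism \<open>\<psi>\<close> extends the identification of the constants with the field. If \<open>e = a - \<psi> a\<close>
were not in the annihilator, it would be invertible modulo the annihilator, while \<open>\<psi> e = 0\<close>.\<close>

lemma acts_by_scalar: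
  assumes a: "a \<in> A"
  shows "\<exists>c. \<forall>v. \<rho> a v = scale c v"
proof -
  let ?R = "range (Poly_Mapping.single 0) :: (tableau \<Rightarrow>\<^sub>0 'k) set"
  note R = subring_constants[where ?'k = 'k]
  obtain w :: 'v where w: "w \<noteq> 0" by (rule nonzero_vector)
  obtain xs where xs: "adjoin_list ?R xs = A" by (rule tableaux_algebra_finitely_generated)
  note iff = annihilator_iff[OF w]
  have one: "1 \<in> adjoin_list ?R xs" "1 \<notin> annihilator"
    using w iff[OF A_closed(1)] A_closed(1) by (simp_all add: xs \<rho>(4))
  have hom: "hom_mod ?R annihilator (\<lambda>a. Poly_Mapping.lookup a 0)"
    unfolding hom_mod_def
  proof (intro conjI ballI impI)
    fix a b :: "tableau \<Rightarrow>\<^sub>0 'k" assume "a \<in> ?R" "b \<in> ?R"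
    then obtain c d where "a = Poly_Mapping.single 0 c" "b = Poly_Mapping.single 0 d" by blast
    then show "Poly_Mapping.lookup (a * b) 0 = Poly_Mapping.lookup a 0 * Poly_Mapping.lookup b 0"
      by (simp add: mult_single)
  next
    fix a :: "tableau \<Rightarrow>\<^sub>0 'k" assume "a \<in> ?R" "a \<in> annihilator"
    then obtain c where "a = Poly_Mapping.single 0 c" "scale c w = 0"
      using iff[OF const_mem] by (auto simp: \<rho>_const)
    then show "Poly_Mapping.lookup a 0 = 0" using w by simp
  qed (simp_all add: lookup_add flip: single_one)
  have I: "prime_ideal_in (adjoin_list ?R xs) annihilator"
    unfolding xs by (rule prime_annihilator)
  obtain d where d: "d \<in> ?R" "d \<notin> annihilator"
    and ext: "\<forall>\<phi>::(tableau \<Rightarrow>\<^sub>0 'k) \<Rightarrow> 'k. hom_mod ?R annihilator \<phi> \<and> \<phi> d \<noteq> 0 \<longrightarrow>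
      (\<exists>\<psi>. hom_mod A annihilator \<psi> \<and> (\<forall>c\<in>?R. \<psi> c = \<phi> c) \<and> \<psi> 1 \<noteq> 0)"
    using extend_hom[OF R I one, where ?'k = 'k] unfolding xs by (elim bexE conjE)
  have d0: "Poly_Mapping.lookup d 0 \<noteq> 0"
  proof
    assume "Poly_Mapping.lookup d 0 = 0"
    with d(1) have "d = 0" by auto
    with d(2) iff[OF A_closed(2)] \<rho>_const[of 0 w] show False by simp
  qed
  obtain \<psi> where \<psi>: "hom_mod A annihilator \<psi>"
    and \<psi>_R: "\<forall>c\<in>?R. \<psi> c = Poly_Mapping.lookup c 0"
    using ext[rule_format, OF conjI[OF hom d0]] by (elim exE conjE)
  have \<psi>_const: "\<psi> (Poly_Mapping.single 0 c) = c" for c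
    using \<psi>_R by simp
  note \<psi> = hom_modD[OF subring_tableaux_algebra \<psi>]
  define e where "e = a - Poly_Mapping.single 0 (\<psi> a)"
  have e: "e \<in> A" unfolding e_def by (intro A_closed a const_mem)
  have \<psi>e: "\<psi> e = 0" unfolding e_def using \<psi>(4)[OF a const_mem] by (simp add: \<psi>_const)
  have "e \<in> annihilator"
  proof (rule ccontr)
    assume "e \<notin> annihilator"
    then have "\<rho> e w \<noteq> 0" using iff[OF e] by simp
    from transitive[OF this, of w] obtain b where b: "b \<in> A" "\<rho> b (\<rho> e w) = w" by blast
    have be: "b * e \<in> A" by (intro A_closed b e)
    have "\<rho> (b * e - 1) w = 0"
      using \<rho>_diff[OF be A_closed(1), of w] b e by (simp add: \<rho>(4,6))
    then have "b * e - 1 \<in> annihilator" using iff[OF A_closed(3)[OF be A_closed(1)]] by simp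
    then have "\<psi> (b * e - 1) = 0" by (intro \<psi>(7) A_closed be)
    moreover have "\<psi> (b * e - 1) = - 1"
      using \<psi>(4)[OF be A_closed(1)] \<psi>(5)[OF b(1) e] \<psi>(1) \<psi>e by simp
    ultimately show False by simp
  qed
  then have "\<rho> e v = 0" for v by (simp add: annihilator_def)
  then have "\<rho> a v = scale (\<psi> a) v" for v
    using \<rho>_diff[OF a const_mem, of "\<psi> a" v] by (simp add: e_def \<rho>_const)
  then show ?thesis by (intro exI allI)
qed

lemma dim_1: "dim UNIV = 1"
proof -
  obtain w :: 'v where w: "w \<noteq> 0" by (rule nonzero_vector)
  have "\<exists>c. v = scale c w" for v
  proof -
    obtain b where b: "b \<in> A" "\<rho> b w = v" using transitive[OF w] by blast
    then show ?thesis using acts_by_scalar[OF b(1)] by auto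
  qed
  with w show ?thesis unfolding dim_eq_1_iff[OF vector_space_axioms] by blast
qed

lemma unique_scalar_family:
  "\<exists>!\<mu>. \<mu> \<in> scalar_families n m \<and> acts_by_scalars n m scale \<rho> \<mu>"
proof -
  obtain w :: 'v where w: "w \<noteq> 0" by (rule nonzero_vector)
  obtain f where f: "\<And>a v. a \<in> A \<Longrightarrow> \<rho> a v = scale (f a) v"
    using acts_by_scalar by metis
  define \<mu> where "\<mu> = (\<lambda>T\<in>one_column n m. f (Poly_Mapping.single T 1))"
  have acts: "acts_by_scalars n m scale \<rho> \<mu>"
    using f by (simp add: acts_by_scalars_def \<mu>_def one_column_in_algebra)
  have prod: "\<rho> (Poly_Mapping.single (S + T) 1) w = scale (\<mu> S * \<mu> T) w"
    if "S \<in> one_column n m" "T \<in> one_column n m" for S T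
  proof -
    have "\<rho> (Poly_Mapping.single (S + T) 1) w = \<rho> (Poly_Mapping.single S 1) (\<rho> (Poly_Mapping.single T 1) w)"
      using \<rho>(6)[OF one_column_in_algebra one_column_in_algebra, OF that] by (simp add: mult_single fun_eq_iff)
    also have "\<dots> = scale (\<mu> S * \<mu> T) w"
      using acts that by (simp add: acts_by_scalars_def)
    finally show ?thesis .
  qed
  have family: "\<mu> \<in> scalar_families n m"
    unfolding scalar_families_def
  proof (intro CollectI conjI ballI impI)
    show "\<mu> \<in> one_column n m \<rightarrow>\<^sub>E UNIV" by (simp add: \<mu>_def)
    fix T1 T2 T3 T4
    assume T: "T1 \<in> one_column n m" "T2 \<in> one_column n m" "T3 \<in> one_column n m" "T4 \<in> one_column n m"
      and "distinct [T1, T2, T3, T4] \<and> T1 + T2 = T3 + T4"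
    then have "scale (\<mu> T1 * \<mu> T2) w = scale (\<mu> T3 * \<mu> T4) w"
      using prod[OF T(1,2)] prod[OF T(3,4)] by auto
    then show "\<mu> T1 * \<mu> T2 = \<mu> T3 * \<mu> T4" using w by simp
  qed
  have "\<nu> = \<mu>" if "\<nu> \<in> scalar_families n m" "acts_by_scalars n m scale \<rho> \<nu>" for \<nu>
  proof (rule extensionalityI[of _ "one_column n m"])
    show "\<nu> \<in> extensional (one_column n m)" "\<mu> \<in> extensional (one_column n m)"
      using that family by (auto simp: scalar_families_def PiE_def)
    fix T assume "T \<in> one_column n m"
    then have "scale (\<nu> T) w = scale (\<mu> T) w"
      using that(2) acts unfolding acts_by_scalars_def by metis
    then show "\<nu> T = \<mu> T" using w by simp
  qed
  with family acts show ?thesis by blast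
qed

end

lemma irreducible_iff_dim_1:
  fixes scale :: "'k::alg_closed_field \<Rightarrow> 'v::ab_group_add \<Rightarrow> 'v"
  assumes "representation n m scale \<rho>"
  shows "irreducible_representation n m scale \<rho> \<longleftrightarrow> vector_space.dim scale UNIV = 1"
  using irreducible_module.dim_1[of n m scale \<rho>] dim_1_imp_irreducible[OF assms]
  unfolding irreducible_module_def by blast

text \<open>An isomorphism preserves eigenvalues. Conversely both representations act by scalars, the same ones
on each side, so any linear bijection between the two lines intertwines them.\<close>

lemma isomorphic_iff_same_scalars:
  assumes dim: "vector_space.dim scale UNIV = 1" "vector_space.dim scale' UNIV = 1"
    and rep: "representation n m scale \<rho>" "representation n m scale' \<rho>'"
    and \<mu>: "\<mu> \<in> scalar_families n m" "\<mu>' \<in> scalar_families n m"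
    and acts: "acts_by_scalars n m scale \<rho> \<mu>" "acts_by_scalars n m scale' \<rho>' \<mu>'"
  shows "isomorphic_representations n m scale \<rho> scale' \<rho>' \<longleftrightarrow> \<mu> = \<mu>'"
proof
  have vs: "vector_space scale" "vector_space scale'"
    using rep by (auto dest: representationD(1))
  interpret V: vector_space scale by (rule vs)
  interpret W: vector_space scale' by (rule vs)
  obtain v where v: "v \<noteq> 0" "\<And>x. \<exists>c. x = scale c v"
    using dim(1) unfolding dim_eq_1_iff[OF vs(1)] by blast
  obtain w where w: "w \<noteq> 0" "\<And>x. \<exists>c. x = scale' c w"
    using dim(2) unfolding dim_eq_1_iff[OF vs(2)] by blast
  {
    assume "isomorphic_representations n m scale \<rho> scale' \<rho>'"
    then obtain f where f: "Vector_Spaces.linear scale scale' f" "bij f"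
      "\<And>a. a \<in> tableaux_algebra n m \<Longrightarrow> f \<circ> \<rho> a = \<rho>' a \<circ> f"
      unfolding isomorphic_representations_def by blast
    have fs: "f (scale c x) = scale' c (f x)" for c x using f(1) by (simp add: Vector_Spaces.linear_iff)
    have "f 0 = 0" using fs[of 0 0] by simp
    then have fv: "f v \<noteq> 0" using v(1) f(2) by (metis bij_pointE)
    show "\<mu> = \<mu>'"
    proof (rule extensionalityI[of _ "one_column n m"])
      show "\<mu> \<in> extensional (one_column n m)" "\<mu>' \<in> extensional (one_column n m)"
        using \<mu> by (auto simp: scalar_families_def PiE_def)
      fix T assume T: "T \<in> one_column n m"
      from fun_cong[OF f(3)[OF one_column_in_algebra[OF T]], of v] have "scale' (\<mu> T) (f v) = scale' (\<mu>' T) (f v)"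
        using acts T by (simp add: acts_by_scalars_def fs)
      then show "\<mu> T = \<mu>' T" using fv by simp
    qed
  next
    assume eq: "\<mu> = \<mu>'"
    obtain coord where coord: "\<And>x. x = scale (coord x) v" using v(2) by metis
    have coord_eq: "coord (scale c v) = c" for c
      using coord[of "scale c v"] v(1) by simp
    define f where "f x = scale' (coord x) w" for x
    have f_scale: "f (scale c v) = scale' c w" for c by (simp add: f_def coord_eq)
    have add: "f (x + y) = f x + f y" for x y
    proof -
      have "x + y = scale (coord x + coord y) v"
        using coord[of x] coord[of y] by (simp add: V.scale_left_distrib)
      then show ?thesis using coord_eq by (metis W.scale_left_distrib f_def)
    qed
    have sc: "f (scale c x) = scale' c (f x)" for c x
    proof -
      have "scale c x = scale (c * coord x) v" using coord[of x] by (metis V.scale_scale)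
      then show ?thesis using coord_eq by (metis W.scale_scale f_def)
    qed
    have "bij f"
    proof (rule bijI)
      show "inj f"
        unfolding inj_def f_def using w(1) coord by (metis W.scale_right_imp_eq)
      show "surj f" unfolding surj_def using w(2) f_scale by metis
    qed
    moreover have "f \<circ> \<rho> a = \<rho>' a \<circ> f" if "a \<in> tableaux_algebra n m" for a
      using representation_eq_scalar_representation[OF rep(1) \<mu>(1) acts(1)]
        representation_eq_scalar_representation[OF rep(2) \<mu>(2) acts(2)] that
      by (auto simp: scalar_representation_def sc eq)
    ultimately show "isomorphic_representations n m scale \<rho> scale' \<rho>'"
      unfolding isomorphic_representations_def using add sc vs by (auto simp: Vector_Spaces.linear_iff)
  }
qed

lemma representation_on_line_unique:
  fixes scale :: "'k::field \<Rightarrow> 'v::ab_group_add \<Rightarrow> 'v"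
  assumes vs: "vector_space scale" and \<mu>: "\<mu> \<in> scalar_families n m"
    and dim: "vector_space.dim scale UNIV = 1" and v: "v \<noteq> 0"
  shows "\<exists>!\<rho>. representation n m scale \<rho> \<and>
    (\<forall>T\<in>one_column n m. \<rho> (Poly_Mapping.single T 1) v = scale (\<mu> T) v)"
proof (intro ex1I conjI)
  show "representation n m scale (scalar_representation n m scale \<mu>)"
    by (rule representation_scalar_representation[OF vs \<mu>])
  show "\<forall>T\<in>one_column n m. scalar_representation n m scale \<mu> (Poly_Mapping.single T 1) v = scale (\<mu> T) v"
    using acts_by_scalars_scalar_representation[OF \<mu>] by (auto simp: acts_by_scalars_def)
next
  interpret vector_space scale by (rule vs)
  fix \<rho> assume \<rho>: "Defs.representation n m scale \<rho> \<and>
    (\<forall>T\<in>one_column n m. \<rho> (Poly_Mapping.single T 1) v = scale (\<mu> T) v)"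
  have "acts_by_scalars n m scale \<rho> \<mu>"
    unfolding acts_by_scalars_def
  proof (intro ballI allI)
    fix T w assume T: "T \<in> one_column n m"
    have lin: "\<rho> (Poly_Mapping.single T 1) (scale c v) = scale c (\<rho> (Poly_Mapping.single T 1) v)" for c
      using representationD(2)[OF conjunct1[OF \<rho>] one_column_in_algebra[OF T]]
      by (simp add: Vector_Spaces.linear_iff)
    obtain c where "w = scale c v" using line_generated_by_any[OF vs dim v] by blast
    then show "\<rho> (Poly_Mapping.single T 1) w = scale (\<mu> T) w"
      using lin \<rho> T by (simp add: mult.commute)
  qed
  with \<rho> \<mu> show "\<rho> = scalar_representation n m scale \<mu>"
    using representation_eq_scalar_representation by blast
qed

lemma vector_space_times: "vector_space (times :: 'k::field \<Rightarrow> 'k \<Rightarrow> 'k)"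
  by unfold_locales (simp_all add: algebra_simps)

lemma irreducible_scalar_representation:
  fixes \<mu> :: "tableau \<Rightarrow> 'k::field"
  assumes "\<mu> \<in> scalar_families n m"
  shows "irreducible_representation n m times (scalar_representation n m (times :: 'k \<Rightarrow> 'k \<Rightarrow> 'k) \<mu>)"
proof (rule dim_1_imp_irreducible)
  show "representation n m times (scalar_representation n m times \<mu>)"
    by (rule representation_scalar_representation[OF vector_space_times assms])
  show "vector_space.dim times (UNIV :: 'k set) = 1"
    unfolding dim_eq_1_iff[OF vector_space_times] by (intro exI[of _ 1]) auto
qed

(* The five conjuncts: irreducible iff one-dimensional; each irreducible representation has a
   unique family of scalars; each family of scalars occurs (on K itself); the family is a complete
   isomorphism invariant; on a space with basis {v}, the family determines the representation. *)
theorem corollary4p1: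
  fixes n m :: nat
    and scale :: "'k::{alg_closed_field,field_char_0} \<Rightarrow> 'v::ab_group_add \<Rightarrow> 'v"
    and scale' :: "'k \<Rightarrow> 'w::ab_group_add \<Rightarrow> 'w"
  assumes "n > 0" and "m \<ge> n" and "vector_space scale" and "vector_space scale'"
  shows
    "(\<forall>\<rho>. representation n m scale \<rho> \<longrightarrow>
       (irreducible_representation n m scale \<rho> \<longleftrightarrow> vector_space.dim scale UNIV = 1)) \<and>
     (\<forall>\<rho>. irreducible_representation n m scale \<rho> \<longrightarrow>
       (\<exists>!\<mu>. \<mu> \<in> scalar_families n m \<and> acts_by_scalars n m scale \<rho> \<mu>)) \<and>
     (\<forall>\<mu> \<in> scalar_families n m. \<exists>\<rho>.
       irreducible_representation n m (times :: 'k \<Rightarrow> 'k \<Rightarrow> 'k) \<rho> \<and> acts_by_scalars n m times \<rho> \<mu>) \<and>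
     (\<forall>\<rho> \<rho>'. \<forall>\<mu> \<in> scalar_families n m. \<forall>\<mu>' \<in> scalar_families n m.
       irreducible_representation n m scale \<rho> \<and> acts_by_scalars n m scale \<rho> \<mu> \<and>
       irreducible_representation n m scale' \<rho>' \<and> acts_by_scalars n m scale' \<rho>' \<mu>' \<longrightarrow>
       (isomorphic_representations n m scale \<rho> scale' \<rho>' \<longleftrightarrow> \<mu> = \<mu>')) \<and>
     (\<forall>\<mu> \<in> scalar_families n m. \<forall>v. vector_space.dim scale UNIV = 1 \<and> v \<noteq> 0 \<longrightarrow>
       (\<exists>!\<rho>. representation n m scale \<rho> \<and>
          (\<forall>T\<in>one_column n m. \<rho> (Poly_Mapping.single T 1) v = scale (\<mu> T) v)))"
proof (intro conjI allI ballI impI)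
  fix \<rho> assume "representation n m scale \<rho>"
  then show "irreducible_representation n m scale \<rho> \<longleftrightarrow> vector_space.dim scale UNIV = 1"
    by (rule irreducible_iff_dim_1)
next
  fix \<rho> assume "irreducible_representation n m scale \<rho>"
  then show "\<exists>!\<mu>. \<mu> \<in> scalar_families n m \<and> acts_by_scalars n m scale \<rho> \<mu>"
    by (intro irreducible_module.unique_scalar_family irreducible_module.intro)
next
  fix \<mu> :: "tableau \<Rightarrow> 'k" assume "\<mu> \<in> scalar_families n m"
  then show "\<exists>\<rho>. irreducible_representation n m (times :: 'k \<Rightarrow> 'k \<Rightarrow> 'k) \<rho> \<and> acts_by_scalars n m times \<rho> \<mu>"
    using irreducible_scalar_representation acts_by_scalars_scalar_representation by blast
next
  fix \<rho> \<rho>' and \<mu> \<mu>' :: "tableau \<Rightarrow> 'k"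
  assume \<mu>: "\<mu> \<in> scalar_families n m" "\<mu>' \<in> scalar_families n m"
    and *: "irreducible_representation n m scale \<rho> \<and> acts_by_scalars n m scale \<rho> \<mu> \<and>
       irreducible_representation n m scale' \<rho>' \<and> acts_by_scalars n m scale' \<rho>' \<mu>'"
  then have rep: "representation n m scale \<rho>" "representation n m scale' \<rho>'"
    by (auto simp: irreducible_representation_def)
  with * show "isomorphic_representations n m scale \<rho> scale' \<rho>' \<longleftrightarrow> \<mu> = \<mu>'"
    using irreducible_iff_dim_1[OF rep(1)] irreducible_iff_dim_1[OF rep(2)]
    by (intro isomorphic_iff_same_scalars \<mu> rep) auto
next
  fix \<mu> :: "tableau \<Rightarrow> 'k" and v :: 'v
  assume "\<mu> \<in> scalar_families n m" "vector_space.dim scale UNIV = 1 \<and> v \<noteq> 0"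
  then show "\<exists>!\<rho>. representation n m scale \<rho> \<and>
      (\<forall>T\<in>one_column n m. \<rho> (Poly_Mapping.single T 1) v = scale (\<mu> T) v)"
    using representation_on_line_unique[OF assms(3)] by blast
qed

end
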